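(* Let $k,n$ be integers with $0\le k\le (n-4)/3$. Let $G=(G_1,\ldots,G_n)$ be a collection of $n$ graphs on a common vertex set $V$ with $|V|=n$, such that $\sigma_2(G_i)\ge n+k$ for all $i\in[n]$. Let $H$ be a linear forest with $k$ edges and $V(H)\subseteq V$, together with an injection $c:E(H)\to[n]$ with $e\in E(G_{c(e)})$ for all $e\in E(H)$ (so $H$ is a rainbow linear forest in $G$); write $c(H)=\{c(e):e\in E(H)\}$. Let $u,v\in V$ be an $H$-compatible pair of vertices. Then at least one of the following holds: (C1) there exists a Hamiltonian path $P$ in the complete graph on $V$ with endpoints $u$ and $v$ that contains $H$ as a subgraph, together with an injection $c':E(P)\to[n]$ extending $c$ such that $e\in E(G_{c'(e)})$ for every $e\in E(P)$ (i.e., a rainbow Hamiltonian $u,v$-path containing $H$); (C2) $H$ has exactly two components, namely $H_u$ and $H_v$, and there exists a partition $X\cup Y$ of $V\setminus V(H)$ with $|X|,|Y|\ge 1$ such that for every color $i\in[n]\setminus c(H)$: in $G_i$, $X$ and $Y$ induce cliques, there are no edges between $X$ and $Y$, and every vertex of $V(H)$ is adjacent to every vertex of $X\cup Y$; (C3) there is a partition $V=X\cup Y$ with $|X|=(n+k)/2$ and $|Y|=(n-k)/2$ such that $V(H)\subseteq X$, and for every $i\in[n]\setminus c(H)$, $G_i[X,Y]$ is complete bipartite and $Y$ is an independent set in $G_i$.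
   Context: For a graph $F$, $\sigma_2(F)=\min\{d_F(x)+d_F(y): x\ne y,\ xy\notin E(F)\}$. A linear forest is a forest every component of which is a path. Given a linear forest $H$, a pair of vertices $u,v$ is $H$-compatible if $d_H(u)\le 1$, $d_H(v)\le 1$, and $u$ and $v$ belong to different components of $H$. Convention: $H$ is regarded as containing $u$ and $v$ (as isolated vertices if they are not incident to edges of $H$), so $V(H)$ is the set of vertices incident to edges of $H$ together with $u$ and $v$; $H_u$ and $H_v$ denote the (distinct) components of $H$ containing $u$ and $v$ respectively, each having $u$, resp. $v$, as an endpoint (possibly a single vertex). $G_i[X,Y]$ denotes the bipartite subgraph of $G_i$ formed by the edges between $X$ and $Y$. *)

theory Defs
  imports Complex_Main "HOL-Library.Extended_Nat"
begin

text \<open>A simple graph on a vertex set \<open>V\<close> is represented by its edge set, a set of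
  two-element subsets of \<open>V\<close>.\<close>

definition simple_graph :: "'a set \<Rightarrow> 'a set set \<Rightarrow> bool" where
  "simple_graph V E \<longleftrightarrow> E \<subseteq> {e. e \<subseteq> V \<and> card e = 2}"

definition degree :: "'a set set \<Rightarrow> 'a \<Rightarrow> nat" where
  "degree E v = card {e \<in> E. v \<in> e}"

text \<open>The minimum over an empty set of non-adjacent pairs (complete graphs) is \<open>\<infinity>\<close>;
  hence the value is an extended natural number.\<close>

definition sigma2 :: "'a set \<Rightarrow> 'a set set \<Rightarrow> enat" where
  "sigma2 V E =
     Inf {enat (degree E x + degree E y) | x y. x \<in> V \<and> y \<in> V \<and> x \<noteq> y \<and> {x, y} \<notin> E}"

definition component :: "'a set \<Rightarrow> 'a set set \<Rightarrow> 'a \<Rightarrow> 'a set" where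
  "component V E x = {y \<in> V. (x, y) \<in> {(a, b). {a, b} \<in> E}\<^sup>*}"

definition components :: "'a set \<Rightarrow> 'a set set \<Rightarrow> 'a set set" where
  "components V E = component V E ` V"

definition path_edges :: "'a list \<Rightarrow> 'a set set" where
  "path_edges xs = {{xs ! i, xs ! Suc i} | i. Suc i < length xs}"

text \<open>A single vertex counts as a path.\<close>

definition is_path :: "'a set \<Rightarrow> 'a set set \<Rightarrow> bool" where
  "is_path V E \<longleftrightarrow> (\<exists>xs. xs \<noteq> [] \<and> distinct xs \<and> set xs = V \<and> path_edges xs = E)"

definition forest :: "'a set set \<Rightarrow> bool" where
  "forest E \<longleftrightarrow>
     \<not> (\<exists>xs. length xs \<ge> 3 \<and> distinct xs \<and> path_edges xs \<subseteq> E \<and> {last xs, hd xs} \<in> E)"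

definition linear_forest :: "'a set \<Rightarrow> 'a set set \<Rightarrow> bool" where
  "linear_forest V E \<longleftrightarrow>
     simple_graph V E \<and> forest E \<and> (\<forall>C \<in> components V E. is_path C {e \<in> E. e \<subseteq> C})"

text \<open>A linear forest \<open>H\<close> is given by its edges; relative to a pair \<open>u\<close>, \<open>v\<close> its vertices are
  those incident to an edge, together with \<open>u\<close> and \<open>v\<close>.\<close>

definition verts_with :: "'a set set \<Rightarrow> 'a \<Rightarrow> 'a \<Rightarrow> 'a set" where
  "verts_with H u v = \<Union>H \<union> {u, v}"

definition compatible :: "'a set set \<Rightarrow> 'a \<Rightarrow> 'a \<Rightarrow> bool" where
  "compatible H u v \<longleftrightarrow> degree H u \<le> 1 \<and> degree H v \<le> 1 \<and>
     component (verts_with H u v) H u \<noteq> component (verts_with H u v) H v"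

definition rainbow :: "nat \<Rightarrow> (nat \<Rightarrow> 'a set set) \<Rightarrow> 'a set set \<Rightarrow> ('a set \<Rightarrow> nat) \<Rightarrow> bool" where
  "rainbow n G F c \<longleftrightarrow> inj_on c F \<and> c ` F \<subseteq> {1..n} \<and> (\<forall>e\<in>F. e \<in> G (c e))"

definition hamiltonian_path :: "'a set \<Rightarrow> 'a \<Rightarrow> 'a \<Rightarrow> 'a list \<Rightarrow> bool" where
  "hamiltonian_path V u v xs \<longleftrightarrow>
     xs \<noteq> [] \<and> distinct xs \<and> set xs = V \<and> hd xs = u \<and> last xs = v"

definition partition2 :: "'a set \<Rightarrow> 'a set \<Rightarrow> 'a set \<Rightarrow> bool" where
  "partition2 S X Y \<longleftrightarrow> X \<union> Y = S \<and> X \<inter> Y = {}"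

definition clique :: "'a set set \<Rightarrow> 'a set \<Rightarrow> bool" where
  "clique E X \<longleftrightarrow> (\<forall>x\<in>X. \<forall>y\<in>X. x \<noteq> y \<longrightarrow> {x, y} \<in> E)"

definition independent_set :: "'a set set \<Rightarrow> 'a set \<Rightarrow> bool" where
  "independent_set E X \<longleftrightarrow> (\<forall>x\<in>X. \<forall>y\<in>X. {x, y} \<notin> E)"

definition edges_between :: "'a set set \<Rightarrow> 'a set \<Rightarrow> 'a set \<Rightarrow> 'a set set" where
  "edges_between E X Y = {e \<in> E. \<exists>x\<in>X. \<exists>y\<in>Y. e = {x, y}}"

definition complete_bipartite :: "'a set \<Rightarrow> 'a set \<Rightarrow> 'a set set \<Rightarrow> bool" where
  "complete_bipartite X Y F \<longleftrightarrow> F = {{x, y} | x y. x \<in> X \<and> y \<in> Y}"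

end

(* Let K be H with the edge uv added. Among the Hamiltonian cycles of the complete graph through K,
   with a partial rainbow colouring that extends c and leaves uv uncoloured, take one with the most
   coloured edges, opened at an uncoloured edge outside K into a path p_0 ... p_(n-1). For two unused
   colours a, b, let S be the set of positions t with p_0 ~ p_(t+1) in G_a, and T the set of those
   with p_t ~ p_(n-1) in G_b. By maximality S and T meet only at edges of K, so the Ore condition for
   both colours is tight throughout: each edge of K lies in both sets, every other edge in exactly
   one, and every path edge except uv is coloured. Write h for an edge of K, and a or b for an edge
   that lies in S only or in T only. Rotating the path at a letter a gives another optimal path,
   which determines the neighbours of p_t; symmetry of adjacency then forces the word of the path to
   be a^p h^q b^r, which is (C2), or a concatenation of words a h^q b, which is (C3). Rotation also
   frees any colour that H does not use, so the structure holds in all of them. *)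

theory Submission
  imports Defs
begin

section \<open>Edges of lists read as paths and cycles\<close>

lemma path_edges_append:
  assumes "as \<noteq> []" "bs \<noteq> []"
  shows "path_edges (as @ bs) = insert {last as, hd bs} (path_edges as \<union> path_edges bs)"
proof -
  have "\<exists>i. e = {(as @ bs) ! i, (as @ bs) ! Suc i} \<and> Suc i < length (as @ bs)"
    if e: "e \<in> insert {last as, hd bs} (path_edges as \<union> path_edges bs)" for e
  proof -
    consider "e = {last as, hd bs}" | i where "e = {as ! i, as ! Suc i}" "Suc i < length as"
      | i where "e = {bs ! i, bs ! Suc i}" "Suc i < length bs"
      using e unfolding path_edges_def by auto
    then show ?thesis
    proof cases
      case 1
      then show ?thesis using assms
        by (intro exI[of _ "length as - 1"])
          (auto simp: nth_append last_conv_nth hd_conv_nth)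
    next
      case (2 i)
      then show ?thesis by (intro exI[of _ i]) (auto simp: nth_append)
    next
      case (3 i)
      then show ?thesis by (intro exI[of _ "length as + i"]) (auto simp: nth_append)
    qed
  qed
  moreover have "{(as @ bs) ! i, (as @ bs) ! Suc i} \<in>
      insert {last as, hd bs} (path_edges as \<union> path_edges bs)"
    if "Suc i < length (as @ bs)" for i
  proof -
    consider "Suc i < length as" | "Suc i = length as" | "length as \<le> i" by linarith
    then show ?thesis
    proof cases
      case 1
      then show ?thesis unfolding path_edges_def by (auto simp: nth_append)
    next
      case 2
      then have "i = length as - 1" by simp
      with 2 show ?thesis using assms by (auto simp: nth_append last_conv_nth hd_conv_nth)
    next
      case 3
      then obtain j where "i = length as + j" using le_Suc_ex by blast
      then show ?thesis using that unfolding path_edges_def by (auto simp: nth_append)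
    qed
  qed
  ultimately show ?thesis unfolding path_edges_def[of "as @ bs"] by blast
qed

lemma path_edges_simps [simp]: "path_edges [] = {}" "path_edges [x] = {}"
  unfolding path_edges_def by auto

lemma path_edges_rev [simp]: "path_edges (rev xs) = path_edges xs"
proof (induction xs)
  case (Cons x xs)
  show ?case
  proof (cases "xs = []")
    case False
    then have "path_edges (rev xs @ [x]) = insert {last (rev xs), x} (path_edges xs)"
      using Cons by (subst path_edges_append) auto
    moreover have "path_edges ([x] @ xs) = insert {x, hd xs} (path_edges xs)"
      using False by (subst path_edges_append) auto
    ultimately show ?thesis using False by (simp add: last_rev insert_commute)
  qed simp
qed simp

lemma path_edges_image: "path_edges xs = (\<lambda>t. {xs ! t, xs ! Suc t}) ` {..<length xs - 1}"
  unfolding path_edges_def by auto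

lemma finite_path_edges [simp]: "finite (path_edges xs)"
  by (simp add: path_edges_image)

lemma path_edges_subset: "e \<in> path_edges xs \<Longrightarrow> e \<subseteq> set xs"
  unfolding path_edges_def by auto

lemma inj_on_path_edge:
  assumes "distinct xs"
  shows "inj_on (\<lambda>t. {xs ! t, xs ! Suc t}) {..<length xs - 1}"
proof (rule inj_onI)
  fix s t assume "s \<in> {..<length xs - 1}" "t \<in> {..<length xs - 1}"
    and "{xs ! s, xs ! Suc s} = {xs ! t, xs ! Suc t}"
  then show "s = t"
    using assms by (auto simp: doubleton_eq_iff nth_eq_iff_index_eq)
qed

lemma card_path_edges: "distinct xs \<Longrightarrow> card (path_edges xs) = length xs - 1"
  unfolding path_edges_image by (subst card_image) (use inj_on_path_edge in auto)

lemma wrap_notin_path_edges: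
  assumes "distinct xs" "length xs \<ge> 3"
  shows "{last xs, hd xs} \<notin> path_edges xs"
proof
  assume "{last xs, hd xs} \<in> path_edges xs"
  then obtain i where i: "Suc i < length xs" "{last xs, hd xs} = {xs ! i, xs ! Suc i}"
    unfolding path_edges_def by auto
  have "xs \<noteq> []" using assms by auto
  then have "{xs ! (length xs - 1), xs ! 0} = {xs ! i, xs ! Suc i}"
    using i by (simp add: last_conv_nth hd_conv_nth)
  moreover have "length xs - 1 < length xs" "0 < length xs" using assms by auto
  ultimately show False
    using i assms by (auto simp: doubleton_eq_iff nth_eq_iff_index_eq)
qed

lemma cross_edge_notin:
  assumes "set as \<inter> set bs = {}" "a \<in> set as" "b \<in> set bs"
  shows "{a, b} \<notin> path_edges as \<union> path_edges bs"
  using assms path_edges_subset[of "{a, b}"] by auto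

definition cyc_edges :: "'a list \<Rightarrow> 'a set set" where
  "cyc_edges xs = insert {last xs, hd xs} (path_edges xs)"

lemma cyc_edges_swap:
  assumes "as \<noteq> []" "bs \<noteq> []"
  shows "cyc_edges (as @ bs) = cyc_edges (bs @ as)"
  using assms unfolding cyc_edges_def by (auto simp: path_edges_append)

lemma cyc_edges_rev: "xs \<noteq> [] \<Longrightarrow> cyc_edges (rev xs) = cyc_edges xs"
  unfolding cyc_edges_def by (simp add: last_rev hd_rev insert_commute)

text \<open>The two-edge exchange: compared with the cycle \<open>as @ bs\<close>, the closing edge
  and the joining edge give way to two new edges, while reversing \<open>bs\<close> leaves the edges
  inside each part alone.\<close>

lemma cyc_edges_exchange:
  assumes "as \<noteq> []" "bs \<noteq> []"
  shows "cyc_edges (as @ rev bs) =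
    path_edges as \<union> path_edges bs \<union> {{last as, last bs}, {hd as, hd bs}}"
  using assms unfolding cyc_edges_def
  by (auto simp: path_edges_append last_rev hd_rev insert_commute)

lemma card_cyc_edges:
  "distinct xs \<Longrightarrow> length xs \<ge> 3 \<Longrightarrow> card (cyc_edges xs) = length xs"
  unfolding cyc_edges_def
  by (simp add: wrap_notin_path_edges card_path_edges)

text \<open>Serves two openings: at \<open>uv\<close>, which gives a path between \<open>u\<close>
  and \<open>v\<close>, and at an uncoloured edge, which gives the path of \<open>opt\<close>. The
  list is turned until \<open>e\<close> is its closing edge.\<close>

lemma cycle_cut:
  assumes "distinct xs" "length xs \<ge> 3" "e \<in> cyc_edges xs"
  obtains ys where "distinct ys" "set ys = set xs" "cyc_edges ys = cyc_edges xs"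
    "{last ys, hd ys} = e" "path_edges ys = cyc_edges xs - {e}"
proof -
  have ex: "\<exists>ys. distinct ys \<and> set ys = set xs \<and> cyc_edges ys = cyc_edges xs \<and>
    {last ys, hd ys} = e \<and> length ys = length xs"
  proof (cases "e = {last xs, hd xs}")
    case True
    then show ?thesis using assms by auto
  next
    case False
    then obtain i where i: "Suc i < length xs" "e = {xs ! i, xs ! Suc i}"
      using assms(3) unfolding cyc_edges_def path_edges_def by auto
    define as bs where "as = take (Suc i) xs" and "bs = drop (Suc i) xs"
    have ne: "as \<noteq> []" "bs \<noteq> []" and xs: "xs = as @ bs"
      using i unfolding as_def bs_def by auto
    have "last as = xs ! i" "hd bs = xs ! Suc i"
      using i unfolding as_def bs_def
      by (auto simp: hd_drop_conv_nth take_Suc_conv_app_nth)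
    then show ?thesis
      using ne i assms(1) cyc_edges_swap[OF ne]
      by (intro exI[of _ "bs @ as"]) (auto simp: xs)
  qed
  then obtain ys where ys: "distinct ys" "set ys = set xs" "cyc_edges ys = cyc_edges xs"
    "{last ys, hd ys} = e" "length ys = length xs" by blast
  moreover have "path_edges ys = cyc_edges xs - {e}"
  proof -
    have "{last ys, hd ys} \<notin> path_edges ys"
      using wrap_notin_path_edges[OF ys(1)] ys(5) assms(2) by simp
    moreover have "cyc_edges xs = insert e (path_edges ys)"
      using ys(3,4) unfolding cyc_edges_def by simp
    ultimately show ?thesis using ys(4) by simp
  qed
  ultimately show ?thesis using that by blast
qed

section \<open>Degrees, the Ore bound and rainbow colourings\<close>

lemma degree_eq_card_neighbours:
  assumes "simple_graph V E" "x \<in> V"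
  shows "degree E x = card {z \<in> V. {x, z} \<in> E}"
proof -
  have "bij_betw (\<lambda>z. {x, z}) {z \<in> V. {x, z} \<in> E} {e \<in> E. x \<in> e}"
  proof (rule bij_betw_imageI)
    show "inj_on (\<lambda>z. {x, z}) {z \<in> V. {x, z} \<in> E}"
      by (auto simp: inj_on_def doubleton_eq_iff)
    show "(\<lambda>z. {x, z}) ` {z \<in> V. {x, z} \<in> E} = {e \<in> E. x \<in> e}"
    proof (intro equalityI subsetI)
      fix e assume e: "e \<in> {e \<in> E. x \<in> e}"
      then have "e \<subseteq> V" "card e = 2" using assms unfolding simple_graph_def by auto
      then obtain a b where "e = {a, b}" by (meson card_2_iff)
      then obtain z where "e = {x, z}" using e by (auto simp: doubleton_eq_iff)
      then show "e \<in> (\<lambda>z. {x, z}) ` {z \<in> V. {x, z} \<in> E}" using e \<open>e \<subseteq> V\<close> by auto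
    qed auto
  qed
  then show ?thesis unfolding degree_def by (simp add: bij_betw_same_card)
qed

lemma simple_graph_no_loop: "simple_graph V E \<Longrightarrow> {x, x} \<notin> E"
  unfolding simple_graph_def by auto

lemma sigma2_le:
  assumes "x \<in> V" "y \<in> V" "x \<noteq> y" "{x, y} \<notin> E" "sigma2 V E \<ge> enat m"
  shows "m \<le> degree E x + degree E y"
proof -
  have "sigma2 V E \<le> enat (degree E x + degree E y)"
    unfolding sigma2_def by (rule Inf_lower) (use assms in blast)
  then show ?thesis using assms(5) by (meson enat_ord_simps(1) order_trans)
qed

lemma rainbow_subset: "rainbow n G F d \<Longrightarrow> F' \<subseteq> F \<Longrightarrow> rainbow n G F' d"
  unfolding rainbow_def by (meson image_mono inj_on_subset subset_iff order_trans)

lemma rainbow_insert: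
  assumes "rainbow n G F d" "a \<in> {1..n} - d ` F" "e \<in> G a" "e \<notin> F"
  shows "rainbow n G (insert e F) (d(e := a))"
proof -
  have "(d(e := a)) ` F = d ` F" using assms(4) by auto
  moreover have "inj_on (d(e := a)) F \<longleftrightarrow> inj_on d F"
    by (rule inj_on_cong) (use assms(4) in auto)
  ultimately show ?thesis using assms unfolding rainbow_def by auto
qed

section \<open>Optimal cycles and the moves that could improve them\<close>

text \<open>\<open>no_rainbow_path\<close> negates (C1). That \<open>H\<close> is a linear forest
  comes in from outside, through the Hamiltonian path from which the first \<open>state\<close> is
  made.\<close>

locale rainbow_setup =
  fixes V :: "'a set" and G :: "nat \<Rightarrow> 'a set set" and H :: "'a set set"
    and c :: "'a set \<Rightarrow> nat" and k n :: nat and u v :: 'a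
  assumes finite_V: "finite V" and card_V: "card V = n" and n_ge_4: "n \<ge> 4"
    and simple_G: "\<And>i. i \<in> {1..n} \<Longrightarrow> simple_graph V (G i)"
    and sigma2_G: "\<And>i. i \<in> {1..n} \<Longrightarrow> sigma2 V (G i) \<ge> enat (n + k)"
    and finite_H: "finite H" and card_H: "card H = k" and uv_notin_H: "{u, v} \<notin> H"
    and no_rainbow_path: "\<And>P c'. hamiltonian_path V u v P \<Longrightarrow> H \<subseteq> path_edges P \<Longrightarrow>
        rainbow n G (path_edges P) c' \<Longrightarrow> \<forall>e\<in>H. c' e = c e \<Longrightarrow> False"
begin

definition K :: "'a set set" where "K = insert {u, v} H"

lemma card_K: "card K = Suc k"
  using finite_H card_H uv_notin_H unfolding K_def by auto

text \<open>A Hamiltonian cycle of the complete graph through \<open>K\<close>, only the edges in \<open>F\<close> of which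
  are coloured. The edge \<open>uv\<close> never needs a colour.\<close>

definition state :: "'a list \<Rightarrow> 'a set set \<Rightarrow> ('a set \<Rightarrow> nat) \<Rightarrow> bool" where
  "state xs F d \<longleftrightarrow> distinct xs \<and> set xs = V \<and> K \<subseteq> cyc_edges xs \<and>
     H \<subseteq> F \<and> F \<subseteq> cyc_edges xs - {{u, v}} \<and> rainbow n G F d \<and> (\<forall>e\<in>H. d e = c e)"

text \<open>The edge that closes the cycle is uncoloured and outside \<open>K\<close>, so \<open>xs\<close> is a path.\<close>

definition opt :: "'a list \<Rightarrow> 'a set set \<Rightarrow> ('a set \<Rightarrow> nat) \<Rightarrow> bool" where
  "opt xs F d \<longleftrightarrow> state xs F d \<and> K \<union> F \<subseteq> path_edges xs \<and>
     (\<forall>xs' F' d'. state xs' F' d' \<longrightarrow> card F' \<le> card F)"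

lemma state_length: "state xs F d \<Longrightarrow> length xs = n"
  unfolding state_def using card_V distinct_card by metis

lemma state_finite: "state xs F d \<Longrightarrow> finite F"
  unfolding state_def cyc_edges_def by (meson Diff_subset finite_insert finite_path_edges finite_subset)

text \<open>Opened at \<open>uv\<close>, such a cycle would be a rainbow Hamiltonian path between
  \<open>u\<close> and \<open>v\<close>. This is the step that uses the failure of (C1).\<close>

lemma state_not_full:
  assumes "state xs F d"
  shows "F \<noteq> cyc_edges xs - {{u, v}}"
proof
  assume F: "F = cyc_edges xs - {{u, v}}"
  have "{u, v} \<in> cyc_edges xs" "distinct xs" "length xs \<ge> 3"
    using assms n_ge_4 state_length[OF assms] unfolding state_def K_def by auto
  then obtain ys where ys: "distinct ys" "set ys = set xs" "{last ys, hd ys} = {u, v}"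
    "path_edges ys = F"
    using cycle_cut[of xs "{u, v}"] F by metis
  have "ys \<noteq> []" using ys assms card_V n_ge_4 unfolding state_def by auto
  define P where "P = (if hd ys = u \<and> last ys = v then ys else rev ys)"
  have "hamiltonian_path V u v P" "path_edges P = F"
    using ys \<open>ys \<noteq> []\<close> assms unfolding P_def hamiltonian_path_def state_def
    by (auto simp: hd_rev last_rev doubleton_eq_iff)
  then show False
    using no_rainbow_path[of P d] assms unfolding state_def by auto
qed

lemma opt_exists:
  assumes "state xs F d"
  shows "\<exists>xs F d. opt xs F d"
proof -
  let ?P = "\<lambda>(xs, F, d). state xs F d"
  have "\<forall>s. ?P s \<longrightarrow> card (fst (snd s)) < Suc n"
  proof (clarsimp simp: less_Suc_eq_le)
    fix xs F d assume st: "state xs F d"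
    have "card F \<le> card (cyc_edges xs)"
      using st unfolding state_def cyc_edges_def by (intro card_mono) auto
    also have "\<dots> = n"
      using card_cyc_edges[of xs] st state_length[OF st] n_ge_4 unfolding state_def by auto
    finally show "card F \<le> n" .
  qed
  then obtain s where "?P s" "\<forall>s'. ?P s' \<longrightarrow> card (fst (snd s')) \<le> card (fst (snd s))"
    using ex_has_greatest_nat[of ?P "(xs, F, d)" "\<lambda>s. card (fst (snd s))" "Suc n"] assms by auto
  then obtain xs F d where st: "state xs F d"
    and mx: "\<And>xs' F' d'. state xs' F' d' \<Longrightarrow> card F' \<le> card F"
    by (cases s) fastforce
  \<comment> \<open>\<open>H\<close> lies inside \<open>F\<close>, so this uncoloured edge other
    than \<open>uv\<close> is outside \<open>K\<close>, and the cycle may be opened there.\<close>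
  obtain e where e: "e \<in> cyc_edges xs" "e \<noteq> {u, v}" "e \<notin> F"
    using state_not_full[OF st] st unfolding state_def by blast
  have "distinct xs" "length xs \<ge> 3"
    using st n_ge_4 state_length[OF st] unfolding state_def by auto
  then obtain ys where "distinct ys" "set ys = set xs" "cyc_edges ys = cyc_edges xs"
    "path_edges ys = cyc_edges xs - {e}"
    using cycle_cut[OF _ _ e(1)] by metis
  then have "opt ys F d" using st e mx unfolding opt_def state_def K_def by auto
  then show ?thesis by blast
qed

lemma opt_state: "opt xs F d \<Longrightarrow> state xs F d"
  unfolding opt_def by simp

lemma opt_max: "opt xs F d \<Longrightarrow> state xs' F' d' \<Longrightarrow> card F' \<le> card F"
  unfolding opt_def by blast

lemma opt_distinct: "opt xs F d \<Longrightarrow> distinct xs"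
  and opt_set: "opt xs F d \<Longrightarrow> set xs = V"
  unfolding opt_def state_def by simp_all

lemma opt_length: "opt xs F d \<Longrightarrow> length xs = n"
  and opt_finite: "opt xs F d \<Longrightarrow> finite F"
  using state_length state_finite opt_state by blast+

text \<open>The closing edge is uncoloured and outside \<open>K\<close>; giving it the colour
  \<open>a\<close> would improve the colouring of the same cycle.\<close>

lemma opt_wrap:
  assumes "opt xs F d" "a \<in> {1..n} - d ` F"
  shows "{last xs, hd xs} \<notin> G a"
proof
  assume a: "{last xs, hd xs} \<in> G a"
  define e where "e = {last xs, hd xs}"
  have new: "e \<notin> path_edges xs"
    using wrap_notin_path_edges[OF opt_distinct[OF assms(1)]] opt_length[OF assms(1)] n_ge_4
    unfolding e_def by simp
  then have ne: "e \<notin> F" "e \<notin> K" using assms unfolding opt_def by auto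
  have "rainbow n G (insert e F) (d(e := a))"
    using rainbow_insert[OF _ assms(2)] a[folded e_def] ne(1) assms(1)
    unfolding opt_def state_def by simp
  then have "state xs (insert e F) (d(e := a))"
    using assms(1) ne unfolding opt_def state_def K_def cyc_edges_def e_def[symmetric] by auto
  from opt_max[OF assms(1) this] show False
    using ne opt_finite[OF assms(1)] by simp
qed

lemma state_rev:
  assumes "state xs F d"
  shows "state (rev xs) F d"
proof -
  have "xs \<noteq> []" using state_length[OF assms] n_ge_4 by auto
  then show ?thesis using assms unfolding state_def by (simp add: cyc_edges_rev)
qed

lemma opt_rev: "opt xs F d \<Longrightarrow> opt (rev xs) F d"
  unfolding opt_def by (simp add: state_rev)

lemma opt_append:
  assumes opt: "opt (as @ bs) F d" and ne: "as \<noteq> []" "bs \<noteq> []"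
    and f: "f = {last as, hd bs}" "f \<notin> K"
  shows "K \<subseteq> path_edges as \<union> path_edges bs" "F - {f} \<subseteq> path_edges as \<union> path_edges bs"
    "H \<subseteq> F - {f}" "rainbow n G (F - {f}) d"
proof -
  have "path_edges (as @ bs) = insert f (path_edges as \<union> path_edges bs)"
    using ne by (simp add: path_edges_append f(1))
  then have "K \<union> F \<subseteq> insert f (path_edges as \<union> path_edges bs)" "H \<subseteq> F" "rainbow n G F d"
    using opt unfolding opt_def state_def by auto
  then show "K \<subseteq> path_edges as \<union> path_edges bs" "F - {f} \<subseteq> path_edges as \<union> path_edges bs"
    "H \<subseteq> F - {f}" "rainbow n G (F - {f}) d"
    using f(2) rainbow_subset[of n G F d "F - {f}"] unfolding K_def by auto
qed

text \<open>Posa rotation: \<open>f\<close> leaves the path and \<open>e\<close> enters with the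
  colour \<open>a\<close>. Were \<open>f\<close> uncoloured, a coloured edge would be gained. Hence
  \<open>f\<close> is coloured, the number of coloured edges stays the same, and the new path is
  again optimal.\<close>

lemma opt_rotate:
  assumes opt: "opt (as @ bs) F d" and ne: "as \<noteq> []" "bs \<noteq> []"
    and e: "e = {hd as, hd bs}" and f: "f = {last as, hd bs}"
    and a: "a \<in> {1..n} - d ` F" and ea: "e \<in> G a" and fK: "f \<notin> K"
  shows "f \<in> F" "opt (rev as @ bs) (insert e (F - {f})) (d(e := a))"
proof -
  let ?F = "insert e (F - {f})"
  note ap = opt_append[OF opt ne f fK]
  have disj: "set as \<inter> set bs = {}" using opt_distinct[OF opt] by auto
  have "e \<notin> path_edges as \<union> path_edges bs"
    using cross_edge_notin[OF disj, of "hd as" "hd bs"] ne unfolding e by simp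
  then have new: "e \<notin> F - {f}" "e \<notin> K" using ap by auto
  have rb: "rainbow n G ?F (d(e := a))"
    using rainbow_insert[OF ap(4) _ ea new(1)] a by auto
  have pe: "path_edges (rev as @ bs) = insert e (path_edges as \<union> path_edges bs)"
    using ne unfolding e by (subst path_edges_append) (simp_all add: last_rev)
  then have cyc: "insert e (path_edges as \<union> path_edges bs) \<subseteq> cyc_edges (rev as @ bs)"
    unfolding cyc_edges_def by blast
  have base: "distinct (as @ bs)" "set (as @ bs) = V" "\<forall>e\<in>H. d e = c e" "{u, v} \<notin> F"
    "{u, v} \<in> K" "H \<subseteq> K"
    using opt unfolding opt_def state_def K_def by auto
  then have "distinct (rev as @ bs)" "set (rev as @ bs) = V" by auto
  moreover have "\<forall>e'\<in>H. (d(e := a)) e' = c e'" "{u, v} \<notin> ?F"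
    using base(3-6) new(2) by (auto simp del: doubleton_eq_iff)
  moreover have "K \<subseteq> cyc_edges (rev as @ bs)" "H \<subseteq> ?F" "?F \<subseteq> cyc_edges (rev as @ bs)"
    using ap(1-3) cyc by blast+
  ultimately have st: "state (rev as @ bs) ?F (d(e := a))"
    using rb unfolding state_def by (simp add: subset_Diff_insert)
  have card: "card ?F = Suc (card (F - {f}))"
    using new opt_finite[OF opt] by simp
  show fF: "f \<in> F"
    using opt_max[OF opt st] card by (cases "f \<in> F") auto
  have "card ?F = card F"
    unfolding card by (rule card_Suc_Diff1[OF opt_finite[OF opt] fF])
  moreover have "K \<union> ?F \<subseteq> path_edges (rev as @ bs)" using ap(1,2) pe by blast
  ultimately show "opt (rev as @ bs) ?F (d(e := a))"
    using opt st unfolding opt_def by simp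
qed

text \<open>The exchange drops the closing edge, which is uncoloured, and the joining edge. At most
  one coloured edge is lost and two are gained, so maximality fails unless the joining edge belongs
  to \<open>K\<close> and may not be dropped.\<close>

lemma opt_exchange:
  assumes opt: "opt (as @ bs) F d" and ne: "as \<noteq> []" "bs \<noteq> []"
    and ab: "a \<in> {1..n} - d ` F" "b \<in> {1..n} - d ` F" "a \<noteq> b"
    and ea: "{hd as, hd bs} \<in> G a" and eb: "{last as, last bs} \<in> G b"
  shows "{last as, hd bs} \<in> K"
proof (rule ccontr)
  define e e' f where "e = {hd as, hd bs}" and "e' = {last as, last bs}" and "f = {last as, hd bs}"
  assume "{last as, hd bs} \<notin> K"
  then have fK: "f \<notin> K" unfolding f_def .
  let ?F = "insert e (F - {f})" and ?d = "d(e := a)"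
  note ap = opt_append[OF opt ne f_def fK]
  have dist: "distinct (as @ bs)" using opt_distinct[OF opt] .
  then have disj: "set as \<inter> set bs = {}" by auto
  have nin: "e \<notin> path_edges as \<union> path_edges bs" "e' \<notin> path_edges as \<union> path_edges bs"
    using cross_edge_notin[OF disj, of "hd as" "hd bs"]
      cross_edge_notin[OF disj, of "last as" "last bs"] ne unfolding e_def e'_def by simp_all
  \<comment> \<open>Two equal new edges would force both parts to be single vertices, hence n =
    2.\<close>
  have "e \<noteq> e'"
  proof
    assume "e = e'"
    moreover have "hd as \<noteq> last bs"
      using disj hd_in_set[OF ne(1)] last_in_set[OF ne(2)] by auto
    ultimately have "hd as = last as" "hd bs = last bs"
      unfolding e_def e'_def by (auto simp: doubleton_eq_iff)
    then have "length as = 1" "length bs = 1"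
      using dist ne by (cases as; cases bs; auto split: if_splits)+
    then show False using opt_length[OF opt] n_ge_4 by simp
  qed
  then have new: "e \<notin> F - {f}" "e \<notin> K" "e' \<notin> ?F" "e' \<notin> K" using ap nin by auto
  have "rainbow n G ?F ?d"
    using rainbow_insert[OF ap(4) _ _ new(1)] ab ea unfolding e_def by auto
  moreover have "b \<in> {1..n} - ?d ` ?F" using ab new(1) by (auto simp: fun_upd_def)
  ultimately have rb: "rainbow n G (insert e' ?F) (?d(e' := b))"
    using rainbow_insert[OF _ _ _ new(3)] eb unfolding e'_def by blast
  have cyc: "cyc_edges (as @ rev bs) = path_edges as \<union> path_edges bs \<union> {e', e}"
    unfolding e_def e'_def by (rule cyc_edges_exchange[OF ne])
  have base: "distinct (as @ bs)" "set (as @ bs) = V" "\<forall>e\<in>H. d e = c e" "{u, v} \<notin> F"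
    "{u, v} \<in> K" "H \<subseteq> K"
    using opt unfolding opt_def state_def K_def by auto
  then have "distinct (as @ rev bs)" "set (as @ rev bs) = V" by auto
  moreover have "\<forall>g\<in>H. (?d(e' := b)) g = c g" "{u, v} \<notin> insert e' ?F"
    using base(3-6) new by (auto simp del: doubleton_eq_iff)
  moreover have "K \<subseteq> cyc_edges (as @ rev bs)" "H \<subseteq> insert e' ?F"
    "insert e' ?F \<subseteq> cyc_edges (as @ rev bs)"
    using ap(1-3) cyc by blast+
  ultimately have st: "state (as @ rev bs) (insert e' ?F) (?d(e' := b))"
    using rb unfolding state_def by (simp add: subset_Diff_insert)
  have "card (insert e' ?F) = Suc (Suc (card (F - {f})))"
    using new opt_finite[OF opt] by simp
  moreover have "card F \<le> Suc (card (F - {f}))"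
    using opt_finite[OF opt] by (cases "f \<in> F") (simp_all add: card_Suc_Diff1)
  ultimately show False using opt_max[OF opt st] by simp
qed

end

section \<open>Counting neighbours by position\<close>

text \<open>For \<open>Suc t < length xs\<close> the last vertex stays in place, which lets its
  adjacencies be compared before and after a rotation.\<close>

definition rot :: "nat \<Rightarrow> 'a list \<Rightarrow> 'a list" where
  "rot t xs = rev (take (Suc t) xs) @ drop (Suc t) xs"

lemma nth_rot: "Suc t < length xs \<Longrightarrow> s < length xs \<Longrightarrow>
    rot t xs ! s = (if s \<le> t then xs ! (t - s) else xs ! s)"
  unfolding rot_def by (auto simp: nth_append rev_nth min_def)

lemma take_drop_ends:
  assumes "Suc t < length xs"
  shows "take (Suc t) xs \<noteq> []" "drop (Suc t) xs \<noteq> []"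
    "hd (take (Suc t) xs) = xs ! 0" "last (take (Suc t) xs) = xs ! t"
    "hd (drop (Suc t) xs) = xs ! Suc t" "last (drop (Suc t) xs) = xs ! (length xs - 1)"
  using assms
  by (auto simp: hd_drop_conv_nth take_Suc_conv_app_nth hd_conv_nth nth_append last_conv_nth
      Suc_diff_Suc numeral_2_eq_2)

text \<open>A position stands for the edge that starts there: a neighbour of the first vertex is
  counted at the edge before it, a neighbour of the last vertex at the edge after it. As there are
  no loops, every neighbour has such an edge.\<close>

lemma card_neighbour_positions:
  assumes "distinct xs" "set xs = V" "simple_graph V E" "xs \<noteq> []"
  shows "card {t. Suc t < length xs \<and> {xs ! 0, xs ! Suc t} \<in> E} = degree E (xs ! 0)" (is "card ?S = _")
    and "card {t. Suc t < length xs \<and> {xs ! t, xs ! (length xs - 1)} \<in> E} =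
      degree E (xs ! (length xs - 1))" (is "card ?T = _")
proof -
  note loop = simple_graph_no_loop[OF assms(3)]
  have "inj_on (\<lambda>t. xs ! Suc t) ?S" "inj_on (\<lambda>t. xs ! t) ?T"
    using assms(1) by (auto simp: inj_on_def nth_eq_iff_index_eq)
  moreover have "(\<lambda>t. xs ! Suc t) ` ?S = {z \<in> V. {xs ! 0, z} \<in> E}"
  proof (intro equalityI subsetI)
    fix z assume z: "z \<in> {z \<in> V. {xs ! 0, z} \<in> E}"
    then obtain s where s: "s < length xs" "z = xs ! s" using assms(2) by (auto simp: in_set_conv_nth)
    moreover have "s \<noteq> 0" using s z loop by (intro notI) auto
    ultimately show "z \<in> (\<lambda>t. xs ! Suc t) ` ?S" using z by (cases s) auto
  qed (use assms(2) in auto)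
  moreover have "(\<lambda>t. xs ! t) ` ?T = {z \<in> V. {xs ! (length xs - 1), z} \<in> E}"
  proof (intro equalityI subsetI)
    fix z assume z: "z \<in> {z \<in> V. {xs ! (length xs - 1), z} \<in> E}"
    then obtain s where s: "s < length xs" "z = xs ! s" using assms(2) by (auto simp: in_set_conv_nth)
    moreover have "s \<noteq> length xs - 1" using s z loop by (intro notI) auto
    ultimately show "z \<in> (\<lambda>t. xs ! t) ` ?T" using z by (auto simp: insert_commute)
  qed (use assms(2) in \<open>auto simp: insert_commute\<close>)
  ultimately have "card ?S = card {z \<in> V. {xs ! 0, z} \<in> E}"
    "card ?T = card {z \<in> V. {xs ! (length xs - 1), z} \<in> E}"
    by (metis (no_types, lifting) card_image)+
  moreover have "xs ! 0 \<in> V" "xs ! (length xs - 1) \<in> V" using assms(2,4) by auto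
  ultimately show "card ?S = degree E (xs ! 0)" "card ?T = degree E (xs ! (length xs - 1))"
    by (simp_all only: degree_eq_card_neighbours[OF assms(3)])
qed

context rainbow_setup
begin

lemma opt_wrap_nth:
  assumes "opt xs F d" "a \<in> {1..n} - d ` F"
  shows "{xs ! 0, xs ! (n - 1)} \<notin> G a"
proof -
  have "xs \<noteq> []" using opt_length[OF assms(1)] n_ge_4 by auto
  then show ?thesis using opt_wrap[OF assms] opt_length[OF assms(1)]
    by (simp add: hd_conv_nth last_conv_nth insert_commute)
qed

lemma opt_exchange_nth:
  assumes "opt xs F d" "a \<in> {1..n} - d ` F" "b \<in> {1..n} - d ` F" "a \<noteq> b" "Suc t < n"
    "{xs ! 0, xs ! Suc t} \<in> G a" "{xs ! t, xs ! (n - 1)} \<in> G b"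
  shows "{xs ! t, xs ! Suc t} \<in> K"
proof -
  have len: "length xs = n" using opt_length assms(1) .
  note ends = take_drop_ends[of t xs, unfolded len, OF assms(5)]
  show ?thesis
    using opt_exchange[of "take (Suc t) xs" "drop (Suc t) xs" F d a b] ends assms by simp
qed

lemma opt_rotate_nth:
  assumes "opt xs F d" "a \<in> {1..n} - d ` F" "Suc t < n" "{xs ! 0, xs ! Suc t} \<in> G a"
    "{xs ! t, xs ! Suc t} \<notin> K"
  shows "{xs ! t, xs ! Suc t} \<in> F"
    "opt (rot t xs) (insert {xs ! 0, xs ! Suc t} (F - {{xs ! t, xs ! Suc t}}))
      (d({xs ! 0, xs ! Suc t} := a))"
proof -
  have len: "length xs = n" using opt_length assms(1) .
  note ends = take_drop_ends[of t xs, unfolded len, OF assms(3)]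
  have "opt (take (Suc t) xs @ drop (Suc t) xs) F d" using assms(1) by simp
  from opt_rotate[OF this ends(1,2) refl refl assms(2), unfolded ends, OF assms(4,5)]
  show "{xs ! t, xs ! Suc t} \<in> F"
    "opt (rot t xs) (insert {xs ! 0, xs ! Suc t} (F - {{xs ! t, xs ! Suc t}}))
      (d({xs ! 0, xs ! Suc t} := a))"
    unfolding rot_def by simp_all
qed

lemma card_K_positions:
  assumes "opt xs F d"
  shows "card {t. Suc t < n \<and> {xs ! t, xs ! Suc t} \<in> K} = Suc k"
proof -
  let ?e = "\<lambda>t. {xs ! t, xs ! Suc t}"
  have len: "length xs = n" using opt_length assms .
  have "inj_on ?e {t. Suc t < n \<and> ?e t \<in> K}"
    by (rule inj_on_subset[OF inj_on_path_edge[OF opt_distinct[OF assms]]]) (auto simp: len)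
  moreover have "?e ` {t. Suc t < n \<and> ?e t \<in> K} = K"
    using assms len unfolding opt_def path_edges_def by auto
  ultimately have "card {t. Suc t < n \<and> ?e t \<in> K} = card K" by (metis (no_types, lifting) card_image)
  then show ?thesis by (simp only: card_K)
qed

lemma opt_types:
  assumes opt: "opt xs F d" and ab: "a \<in> {1..n} - d ` F" "b \<in> {1..n} - d ` F" "a \<noteq> b"
  shows "degree (G a) (xs ! 0) + degree (G b) (xs ! (n - 1)) = n + k"
    and "\<And>t. Suc t < n \<Longrightarrow> {xs ! t, xs ! Suc t} \<in> K \<Longrightarrow>
      {xs ! 0, xs ! Suc t} \<in> G a \<and> {xs ! t, xs ! (n - 1)} \<in> G b"
    and "\<And>t. Suc t < n \<Longrightarrow> {xs ! t, xs ! Suc t} \<notin> K \<Longrightarrow>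
      {xs ! 0, xs ! Suc t} \<in> G a \<longleftrightarrow> {xs ! t, xs ! (n - 1)} \<notin> G b"
proof -
  let ?L = "\<lambda>a. {t. Suc t < n \<and> {xs ! 0, xs ! Suc t} \<in> G a}"
  let ?R = "\<lambda>a. {t. Suc t < n \<and> {xs ! t, xs ! (n - 1)} \<in> G a}"
  let ?K = "{t. Suc t < n \<and> {xs ! t, xs ! Suc t} \<in> K}"
  have len: "length xs = n" and ne: "xs \<noteq> []" using opt_length[OF opt] n_ge_4 by auto
  have V: "xs ! 0 \<in> V" "xs ! (n - 1) \<in> V" using opt_set[OF opt] ne len by auto
  have neq: "xs ! 0 \<noteq> xs ! (n - 1)"
    using opt_distinct[OF opt] len n_ge_4 by (auto simp: nth_eq_iff_index_eq)
  have fin: "finite (?L e)" "finite (?R e)" "finite ?K" for e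
    by (rule finite_subset[of _ "{..<n}"]; auto)+
  have cards: "card (?L e) = degree (G e) (xs ! 0)" "card (?R e) = degree (G e) (xs ! (n - 1))"
    if "e \<in> {1..n}" for e
    using card_neighbour_positions[OF opt_distinct[OF opt] opt_set[OF opt] simple_G[OF that] ne]
    by (simp_all add: len)
  have ore: "n + k \<le> degree (G e) (xs ! 0) + degree (G e) (xs ! (n - 1))"
    if "e \<in> {1..n} - d ` F" for e
    using sigma2_le[OF V neq opt_wrap_nth[OF opt that]] sigma2_G that by auto
  have int: "?L e \<inter> ?R e' \<subseteq> ?K"
    if "e \<in> {1..n} - d ` F" "e' \<in> {1..n} - d ` F" "e \<noteq> e'" for e e'
    using opt_exchange_nth[OF opt that] by auto
  have un: "?L e \<union> ?R e' \<subseteq> {..<n - 1}" for e e' by auto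
  have sum: "card (?L e) + card (?R e') = card (?L e \<union> ?R e') + card (?L e \<inter> ?R e')" for e e'
    by (rule card_Un_Int[OF fin(1,2)])
  have le: "card (?L e \<inter> ?R e') \<le> Suc k" "card (?L e \<union> ?R e') \<le> n - 1"
    if "e \<in> {1..n} - d ` F" "e' \<in> {1..n} - d ` F" "e \<noteq> e'" for e e'
    using card_mono[OF fin(3) int[OF that]] card_mono[OF _ un[of e e']]
      card_K_positions[OF opt] by auto
  have ab': "a \<in> {1..n}" "b \<in> {1..n}" using ab by auto
  have "n + k \<le> card (?L a) + card (?R a)" "n + k \<le> card (?L b) + card (?R b)"
    using ore ab cards ab' by simp_all
  then have eq: "card (?L a \<inter> ?R b) = Suc k" "card (?L a \<union> ?R b) = n - 1"
    "card (?L a) + card (?R b) = n + k"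
    using sum[of a b] sum[of b a] le[OF ab] le[OF ab(2,1)] ab(3) n_ge_4 by linarith+
  show "degree (G a) (xs ! 0) + degree (G b) (xs ! (n - 1)) = n + k"
    using eq(3) cards ab' by simp
  have i: "?L a \<inter> ?R b = ?K"
    using eq(1) card_K_positions[OF opt] int[OF ab] by (intro card_subset_eq fin) auto
  have u: "?L a \<union> ?R b = {..<n - 1}"
    using eq(2) un by (intro card_subset_eq) auto
  fix t assume t: "Suc t < n"
  show "{xs ! 0, xs ! Suc t} \<in> G a \<and> {xs ! t, xs ! (n - 1)} \<in> G b"
    if "{xs ! t, xs ! Suc t} \<in> K"
    using i that t by blast
  show "{xs ! 0, xs ! Suc t} \<in> G a \<longleftrightarrow> {xs ! t, xs ! (n - 1)} \<notin> G b"
    if "{xs ! t, xs ! Suc t} \<notin> K"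
  proof -
    have "t \<in> ?L a \<union> ?R b" "t \<notin> ?L a \<inter> ?R b" using i u that t by auto
    then show ?thesis using t by blast
  qed
qed

lemma opt_free_colours:
  assumes opt: "opt xs F d"
  obtains a b where "a \<in> {1..n} - d ` F" "b \<in> {1..n} - d ` F" "a \<noteq> b"
proof -
  have F: "F \<subseteq> path_edges xs - {{u, v}}" "{u, v} \<in> path_edges xs" "d ` F \<subseteq> {1..n}"
    using opt unfolding opt_def state_def K_def rainbow_def by auto
  then have "card F \<le> card (path_edges xs) - 1"
    using card_mono[OF _ F(1)] by simp
  also have "\<dots> = n - 2"
    using card_path_edges[OF opt_distinct[OF opt]] opt_length[OF opt] by simp
  finally have "card (d ` F) \<le> n - 2"
    using card_image_le[OF opt_finite[OF opt], of d] by linarith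
  moreover have "card ({1..n} - d ` F) = n - card (d ` F)"
    using F(3) opt_finite[OF opt] by (subst card_Diff_subset) auto
  ultimately have "\<not> card ({1..n} - d ` F) \<le> Suc 0" using n_ge_4 by linarith
  then show ?thesis using that card_le_Suc0_iff_eq[of "{1..n} - d ` F"] by blast
qed

text \<open>By \<open>opt_types\<close> every edge outside \<open>K\<close> can be removed by a
  rotation of the path or of its reversal, and a rotation only ever removes a coloured edge.\<close>

lemma opt_all_coloured:
  assumes opt: "opt xs F d"
  shows "F = path_edges xs - {{u, v}}"
proof -
  obtain a b where ab: "a \<in> {1..n} - d ` F" "b \<in> {1..n} - d ` F" "a \<noteq> b"
    using opt_free_colours[OF opt] .
  have len: "length xs = n" using opt_length[OF opt] .
  have "e \<in> F" if e: "e \<in> path_edges xs" "e \<noteq> {u, v}" for e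
  proof (rule ccontr)
    assume F: "e \<notin> F"
    obtain t where t: "Suc t < n" "e = {xs ! t, xs ! Suc t}"
      using e len unfolding path_edges_def by auto
    have K: "e \<notin> K" using F e opt unfolding opt_def state_def K_def by auto
    consider "{xs ! 0, xs ! Suc t} \<in> G a" | "{xs ! t, xs ! (n - 1)} \<in> G b"
      using opt_types(3)[OF opt ab t(1)] K t(2) by auto
    then show False
    proof cases
      case 1
      then show ?thesis using opt_rotate_nth(1)[OF opt ab(1) t(1)] F K t(2) by simp
    next
      case 2
      \<comment> \<open>Edges occupy the positions 0 to n - 2, so reversal moves the edge at
        \<open>t\<close> to n - 2 - t; vertices move from \<open>t\<close> to n - 1 - t.\<close>
      let ?s = "n - 2 - t"
      have "rev xs ! 0 = xs ! (n - 1)" "rev xs ! Suc ?s = xs ! t" "rev xs ! ?s = xs ! Suc t"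
        "Suc ?s < n"
        using t(1) len by (auto simp: rev_nth Suc_diff_Suc)
      then show ?thesis
        using opt_rotate_nth(1)[OF opt_rev[OF opt] ab(2), of ?s] 2 F K t(2)
        by (simp add: insert_commute)
    qed
  qed
  then show ?thesis using opt unfolding opt_def state_def by auto
qed

text \<open>Here \<open>i\<close> and \<open>j\<close> are the two colours that an optimal path leaves unused.\<close>

definition full :: "'a list \<Rightarrow> ('a set \<Rightarrow> nat) \<Rightarrow> nat \<Rightarrow> nat \<Rightarrow> bool" where
  "full xs d i j \<longleftrightarrow> opt xs (path_edges xs - {{u, v}}) d \<and> i \<noteq> j \<and>
     i \<in> {1..n} - d ` (path_edges xs - {{u, v}}) \<and> j \<in> {1..n} - d ` (path_edges xs - {{u, v}})"

lemma full_exists: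
  assumes "state xs F d"
  shows "\<exists>xs d i j. full xs d i j"
proof -
  obtain xs F d where opt: "opt xs F d" using opt_exists[OF assms] by blast
  then have F: "F = path_edges xs - {{u, v}}" using opt_all_coloured by simp
  show ?thesis
    using opt_free_colours[OF opt] opt unfolding full_def F by metis
qed

lemma full_commute: "full xs d i j \<Longrightarrow> full xs d j i"
  unfolding full_def by auto

lemma full_rev: "full xs d i j \<Longrightarrow> full (rev xs) d i j"
  unfolding full_def using opt_rev by auto

lemma full_length: "full xs d i j \<Longrightarrow> length xs = n"
  and full_distinct: "full xs d i j \<Longrightarrow> distinct xs"
  and full_set: "full xs d i j \<Longrightarrow> set xs = V"
  unfolding full_def by (auto dest: opt_length opt_distinct opt_set)

text \<open>The rotation spends \<open>i\<close> and releases the colour of the deleted edge, which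
  injectivity of \<open>d\<close> keeps off all other edges.\<close>

lemma full_rotate:
  assumes full: "full xs d i j" and t: "Suc t < n" and e: "{xs ! 0, xs ! Suc t} \<in> G i"
    and K: "{xs ! t, xs ! Suc t} \<notin> K"
  shows "full (rot t xs) (d({xs ! 0, xs ! Suc t} := i)) j (d {xs ! t, xs ! Suc t})"
proof -
  define F e f where "F = path_edges xs - {{u, v}}" and "e = {xs ! 0, xs ! Suc t}"
    and "f = {xs ! t, xs ! Suc t}"
  let ?F = "insert e (F - {f})" and ?d = "d(e := i)"
  have opt: "opt xs F d" and ij: "i \<noteq> j" "i \<in> {1..n} - d ` F" "j \<in> {1..n} - d ` F"
    using full unfolding full_def F_def by auto
  have fF: "f \<in> F" and opt': "opt (rot t xs) ?F ?d"
    using opt_rotate_nth[OF opt ij(2) t] assms(3,4) unfolding e_def f_def by auto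
  have rb: "inj_on d F" "d ` F \<subseteq> {1..n}" using opt unfolding opt_def state_def rainbow_def by auto
  have img: "?d ` ?F \<subseteq> insert i (d ` (F - {f}))" by auto
  have "d f \<notin> d ` (F - {f})" using rb(1) fF by (auto simp: inj_on_def)
  moreover have "d f \<in> {1..n}" "d f \<noteq> i" "d f \<noteq> j" using rb fF ij by auto
  ultimately have "d f \<in> {1..n} - ?d ` ?F" "j \<noteq> d f" using img by auto
  moreover have "j \<in> {1..n} - ?d ` ?F" using img ij by auto
  moreover have "?F = path_edges (rot t xs) - {{u, v}}" using opt_all_coloured[OF opt'] .
  ultimately show ?thesis using opt' unfolding full_def e_def[symmetric] f_def[symmetric] by simp
qed

text \<open>The first edge can be recoloured with either free colour, which frees its own colour. Comparing
  the three pairs out of these three colours shows that the types do not depend on the colour.\<close>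

lemma full_types:
  assumes full: "full xs d i j" and t: "Suc t < n"
  shows "{xs ! t, xs ! Suc t} \<in> K \<Longrightarrow> {xs ! 0, xs ! Suc t} \<in> G i"
    and "{xs ! t, xs ! Suc t} \<in> K \<Longrightarrow> {xs ! t, xs ! (n - 1)} \<in> G i"
    and "{xs ! t, xs ! Suc t} \<notin> K \<Longrightarrow>
      {xs ! 0, xs ! Suc t} \<in> G i \<longleftrightarrow> {xs ! t, xs ! (n - 1)} \<notin> G i"
    and "{xs ! t, xs ! (n - 1)} \<in> G i \<longleftrightarrow> {xs ! t, xs ! (n - 1)} \<in> G j"
proof -
  let ?F = "path_edges xs - {{u, v}}" and ?e = "{xs ! 0, xs ! Suc 0}"
  have types: "{xs ! t, xs ! Suc t} \<in> K \<longrightarrow>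
      {xs ! 0, xs ! Suc t} \<in> G a \<and> {xs ! t, xs ! (n - 1)} \<in> G b"
    "{xs ! t, xs ! Suc t} \<notin> K \<longrightarrow>
      ({xs ! 0, xs ! Suc t} \<in> G a \<longleftrightarrow> {xs ! t, xs ! (n - 1)} \<notin> G b)"
    "{xs ! 0, xs ! (n - 1)} \<notin> G b"
    if "full xs d a b" "Suc t < n" for d a b t
  proof -
    have opt: "opt xs ?F d" "a \<in> {1..n} - d ` ?F" "b \<in> {1..n} - d ` ?F" "a \<noteq> b"
      using that(1) unfolding full_def by simp_all
    show "{xs ! t, xs ! Suc t} \<in> K \<longrightarrow> {xs ! 0, xs ! Suc t} \<in> G a \<and> {xs ! t, xs ! (n - 1)} \<in> G b"
      using opt_types(2)[OF opt that(2)] by (rule impI)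
    show "{xs ! t, xs ! Suc t} \<notin> K \<longrightarrow>
        ({xs ! 0, xs ! Suc t} \<in> G a \<longleftrightarrow> {xs ! t, xs ! (n - 1)} \<notin> G b)"
      using opt_types(3)[OF opt that(2)] by (rule impI)
    show "{xs ! 0, xs ! (n - 1)} \<notin> G b" by (rule opt_wrap_nth[OF opt(1,3)])
  qed
  have 0: "Suc 0 < n" using n_ge_4 by simp
  have e: "?e \<notin> K" using types(1,3)[OF full 0] 0 by auto
  have eG: "?e \<in> G a" if "full xs d a b" for a b
    using types(2,3)[OF that 0] 0 e by auto
  \<comment> \<open>Rotating at 0 reverses a single vertex: the path stays and only its first edge
    is recoloured.\<close>
  have [simp]: "rot 0 xs = xs" unfolding rot_def using full_length[OF full] n_ge_4 by (cases xs) auto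
  define l where "l = d ?e"
  have "full xs (d(?e := i)) j l" "full xs (d(?e := j)) i l"
    using full_rotate[OF full 0 eG[OF full] e]
      full_rotate[OF full_commute[OF full] 0 eG[OF full_commute[OF full]] e]
    unfolding l_def by simp_all
  note fs = full this this[THEN full_commute] full_commute[OF full]
  note T = fs[THEN types(1), OF t] fs[THEN types(2), OF t]
  show "{xs ! t, xs ! Suc t} \<in> K \<Longrightarrow> {xs ! 0, xs ! Suc t} \<in> G i"
    and "{xs ! t, xs ! Suc t} \<in> K \<Longrightarrow> {xs ! t, xs ! (n - 1)} \<in> G i"
    and "{xs ! t, xs ! Suc t} \<notin> K \<Longrightarrow>
      {xs ! 0, xs ! Suc t} \<in> G i \<longleftrightarrow> {xs ! t, xs ! (n - 1)} \<notin> G i"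
    and "{xs ! t, xs ! (n - 1)} \<in> G i \<longleftrightarrow> {xs ! t, xs ! (n - 1)} \<in> G j"
    using T by argo+
qed

lemma full_wrap: "full xs d i j \<Longrightarrow> {xs ! 0, xs ! (n - 1)} \<notin> G i"
  unfolding full_def using opt_wrap_nth by blast

text \<open>The edge at position \<open>t\<close> carries the letter \<open>a\<close>.\<close>

definition ltype :: "'a list \<Rightarrow> nat \<Rightarrow> nat \<Rightarrow> bool" where
  "ltype xs i t \<longleftrightarrow> {xs ! t, xs ! Suc t} \<notin> K \<and> {xs ! t, xs ! (n - 1)} \<notin> G i"

text \<open>A rotation at \<open>t\<close> makes \<open>xs ! t\<close> the first vertex, so the
  types of the rotated path, decided at the unchanged last vertex, list the neighbours of
  \<open>xs ! t\<close>. The prefix is traversed backwards, which is why \<open>r < t\<close>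
  involves the letter at \<open>Suc r\<close> instead of the one at \<open>r\<close>.\<close>

lemma full_adjacency:
  assumes full: "full xs d i j" and t: "Suc t < n" and A: "ltype xs i t"
  shows "\<And>r. r < t \<Longrightarrow> {xs ! t, xs ! r} \<in> G i \<longleftrightarrow> ltype xs i (Suc r) \<or> {xs ! r, xs ! Suc r} \<in> K"
    and "\<And>s. t < s \<Longrightarrow> Suc s < n \<Longrightarrow>
      {xs ! t, xs ! Suc s} \<in> G i \<longleftrightarrow> ltype xs i s \<or> {xs ! s, xs ! Suc s} \<in> K"
    and "{xs ! t, xs ! Suc t} \<in> G i"
    and "\<And>r. Suc r = t \<Longrightarrow> {xs ! r, xs ! Suc r} \<notin> K"
proof -
  let ?zs = "rot t xs"
  have len: "length xs = n" using full_length[OF full] .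
  have nth: "?zs ! s = (if s \<le> t then xs ! (t - s) else xs ! s)" if "s < n" for s
    using nth_rot[of t xs s] len t that by simp
  have last: "?zs ! (n - 1) = xs ! (n - 1)" and first: "?zs ! 0 = xs ! t"
    using nth[of "n - 1"] nth[of 0] t by auto
  note full' = full_commute[OF full]
  have "{xs ! t, xs ! (n - 1)} \<notin> G j"
    using A full_types(4)[OF full t] unfolding ltype_def by simp
  then have e: "{xs ! 0, xs ! Suc t} \<in> G j" and K: "{xs ! t, xs ! Suc t} \<notin> K"
    using A full_types(3)[OF full' t] unfolding ltype_def by auto
  obtain d' l where zs: "full ?zs d' i l" using full_rotate[OF full' t e K] by blast
  note ty = full_types(1-3)[OF zs, unfolded last first]
  {
    fix r assume r: "r < t"
    have "?zs ! (t - Suc r) = xs ! Suc r" "?zs ! Suc (t - Suc r) = xs ! r" "Suc (t - Suc r) < n"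
      using r t nth[of "t - Suc r"] nth[of "Suc (t - Suc r)"] by (auto simp: Suc_diff_Suc)
    note * = ty[of "t - Suc r", unfolded this, OF this(3)]
    \<comment> \<open>Nonadjacency to the last vertex already rules out an edge of \<open>K\<close>
      at \<open>Suc r\<close>, so it amounts to \<open>ltype\<close> there.\<close>
    have "{xs ! Suc r, xs ! Suc (Suc r)} \<in> K \<Longrightarrow> {xs ! Suc r, xs ! (n - 1)} \<in> G i"
      using full_types(2)[OF full, of "Suc r"] r t by simp
    then show "{xs ! t, xs ! r} \<in> G i \<longleftrightarrow> ltype xs i (Suc r) \<or> {xs ! r, xs ! Suc r} \<in> K"
      using * unfolding ltype_def by (auto simp: insert_commute)
    have "{xs ! r, xs ! Suc r} \<notin> K" if "Suc r = t"
      using *(2) A that unfolding ltype_def by (auto simp: insert_commute)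
  }
  then show "{xs ! r, xs ! Suc r} \<notin> K" if "Suc r = t" for r using that by blast
  {
    fix s assume s: "t < s" "Suc s < n"
    have "?zs ! s = xs ! s" "?zs ! Suc s = xs ! Suc s" using s nth[of s] nth[of "Suc s"] by auto
    note * = ty[of s, unfolded this, OF s(2)]
    then show "{xs ! t, xs ! Suc s} \<in> G i \<longleftrightarrow> ltype xs i s \<or> {xs ! s, xs ! Suc s} \<in> K"
      unfolding ltype_def by auto
  }
  \<comment> \<open>In the rotated path the vertex at \<open>t\<close> is the old first vertex,
    which is not adjacent to the last one.\<close>
  have "?zs ! t = xs ! 0" "?zs ! Suc t = xs ! Suc t" using t nth[of t] nth[of "Suc t"] by auto
  note * = ty[of t, unfolded this, OF t]
  then show "{xs ! t, xs ! Suc t} \<in> G i" using full_wrap[OF full] by blast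
qed

end

section \<open>Words over a, b and h\<close>

text \<open>In a word over \<open>a\<close>, \<open>b\<close>, \<open>h\<close> read off a Hamiltonian path, \<open>A t\<close> and \<open>h t\<close> say that the letter
  at position \<open>t\<close> is \<open>a\<close>, respectively \<open>h\<close>.\<close>

lemma word_structure:
  fixes A h :: "nat \<Rightarrow> bool"
  assumes N: "N \<ge> 3"
    and disj: "\<And>t. A t \<Longrightarrow> \<not> h t"
    and first: "A 0" and last: "\<not> A (N - 1)" "\<not> h (N - 1)"
    and hA: "\<And>t. Suc t < N \<Longrightarrow> h t \<Longrightarrow> \<not> A (Suc t)"
    and Bh: "\<And>t. Suc t < N \<Longrightarrow> \<not> h t \<Longrightarrow> \<not> A t \<Longrightarrow> \<not> h (Suc t)"
    and aa: "\<And>s t. Suc s < t \<Longrightarrow> t < N \<Longrightarrow> A s \<Longrightarrow> A t \<Longrightarrow> A (Suc s) \<longleftrightarrow> A (t - 1)"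
    and bb: "\<And>s t. Suc s < t \<Longrightarrow> t < N \<Longrightarrow> \<not> A s \<Longrightarrow> \<not> h s \<Longrightarrow> \<not> A t \<Longrightarrow> \<not> h t \<Longrightarrow>
      \<not> A (Suc s) \<and> \<not> h (Suc s) \<longleftrightarrow> \<not> A (t - 1) \<and> \<not> h (t - 1)"
  shows "(\<exists>p m. \<forall>t<N. (A t \<longleftrightarrow> t < p) \<and> (h t \<longleftrightarrow> p \<le> t \<and> t < m)) \<or>
    (\<forall>t. Suc t < N \<longrightarrow> (A (Suc t) \<longleftrightarrow> \<not> h t \<and> \<not> A t))"
proof -
  define B where "B t \<longleftrightarrow> \<not> A t \<and> \<not> h t" for t
  have blocks: ?thesis
    if A: "\<And>t. Suc t < N \<Longrightarrow> A (Suc t) \<Longrightarrow> A t" and B: "\<And>t. Suc t < N \<Longrightarrow> B t \<Longrightarrow> B (Suc t)"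
  proof -
    have A': "A s" if "s \<le> t" "t < N" "A t" for s t
      using that by (induction rule: inc_induct) (auto intro: A)
    have B': "B t" if "s \<le> t" "t < N" "B s" for s t
      using that by (induction rule: dec_induct) (auto intro: B)
    define p m where "p = (LEAST t. \<not> A t)" and "m = (LEAST t. B t)"
    have p: "\<not> A p" "\<And>t. t < p \<Longrightarrow> A t"
      unfolding p_def using LeastI[of "\<lambda>t. \<not> A t", OF last(1)] not_less_Least by blast+
    have "B (N - 1)" using last unfolding B_def by simp
    then have m: "B m" "\<And>t. t < m \<Longrightarrow> \<not> B t"
      unfolding m_def using LeastI[of B] not_less_Least by blast+
    have "(A t \<longleftrightarrow> t < p) \<and> (h t \<longleftrightarrow> p \<le> t \<and> t < m)" if t: "t < N" for t
    proof -
      have "A t \<longleftrightarrow> t < p" using p A'[OF _ t, of p] by (meson not_le)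
      moreover have "B t \<longleftrightarrow> m \<le> t" using m B'[OF _ t, of m] by (meson not_le)
      ultimately show ?thesis using disj unfolding B_def by (meson not_le)
    qed
    then show ?thesis by blast
  qed
  \<comment> \<open>Every later a is compared with the first letter by \<open>aa\<close>, every
    earlier b with the last letter by \<open>bb\<close>. So the second letter decides whether all
    later letters a follow an a, and the last but one whether all earlier letters b precede a b. If
    neither holds, each a after the first follows a b and each b before the last precedes an
    a.\<close>
  consider "A 1" | "B (N - 2)" | "\<not> A 1" "\<not> B (N - 2)" by blast
  then show ?thesis
  proof cases
    case 1
    have A: "A t" if "Suc t < N" "A (Suc t)" for t
      using that first aa[of 0 "Suc t"] 1 by (cases "t = 0") auto
    then show ?thesis
      by (intro blocks) (use Bh in \<open>auto simp: B_def\<close>)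
  next
    case 2
    have B: "B (Suc t)" if "Suc t < N" "B t" for t
    proof (cases "Suc t = N - 1")
      case False
      then show ?thesis
        using that last bb[of t "N - 1"] 2 unfolding B_def by (auto simp: numeral_2_eq_2)
    qed (use last in \<open>auto simp: B_def\<close>)
    then show ?thesis
      by (intro blocks) (use hA in \<open>auto simp: B_def\<close>)
  next
    case 3
    have "B t" if "Suc t < N" "A (Suc t)" for t
      using that first aa[of 0 "Suc t"] 3 hA[of t] by (cases "t = 0") (auto simp: B_def)
    moreover have "A (Suc t)" if "Suc t < N" "B t" for t
    proof -
      have "t \<noteq> N - 2" using that 3 by auto
      then show ?thesis
        using that last bb[of t "N - 1"] 3 Bh[of t] unfolding B_def by (auto simp: numeral_2_eq_2)
    qed
    ultimately show ?thesis unfolding B_def by blast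
  qed
qed

lemma complete_bipartite_edges_between:
  assumes "\<And>x y. x \<in> X \<Longrightarrow> y \<in> Y \<Longrightarrow> {x, y} \<in> E"
  shows "complete_bipartite X Y (edges_between E X Y)"
  using assms unfolding complete_bipartite_def edges_between_def by blast

section \<open>The word of an optimal path\<close>

context rainbow_setup
begin

definition hpos :: "'a list \<Rightarrow> nat \<Rightarrow> bool" where
  "hpos xs t \<longleftrightarrow> {xs ! t, xs ! Suc t} \<in> K"

lemma ltype_not_hpos: "ltype xs i t \<Longrightarrow> \<not> hpos xs t"
  unfolding ltype_def hpos_def by simp

lemma adjacent_last:
  "full xs d i j \<Longrightarrow> Suc t < n \<Longrightarrow> {xs ! t, xs ! (n - 1)} \<in> G i \<longleftrightarrow> \<not> ltype xs i t"
  using full_types(2) unfolding ltype_def by blast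

lemma ltype_commute: "full xs d i j \<Longrightarrow> Suc t < n \<Longrightarrow> ltype xs i t \<longleftrightarrow> ltype xs j t"
  using full_types(4) unfolding ltype_def by blast

lemma nth_rev_full:
  assumes "full xs d i j" "t < n"
  shows "rev xs ! t = xs ! (n - 1 - t)"
  using assms full_length[OF assms(1)] by (simp add: rev_nth)

lemma hpos_rev:
  assumes "full xs d i j" "Suc t < n"
  shows "hpos (rev xs) t \<longleftrightarrow> hpos xs (n - 2 - t)"
  using assms unfolding hpos_def
  by (simp add: nth_rev_full[OF assms(1)] insert_commute Suc_diff_Suc numeral_2_eq_2)

text \<open>Reversal exchanges the letters a and b, where b is expressed as neither
  \<open>hpos\<close> nor \<open>ltype\<close>. Facts about b follow from those about a in this
  way.\<close>

lemma ltype_rev: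
  assumes full: "full xs d i j" and t: "Suc t < n"
  shows "ltype (rev xs) i t \<longleftrightarrow> \<not> hpos xs (n - 2 - t) \<and> \<not> ltype xs i (n - 2 - t)"
proof -
  let ?s = "n - 2 - t"
  have s: "Suc ?s = n - 1 - t" "Suc ?s < n" using t by auto
  have "{rev xs ! t, rev xs ! (n - 1)} = {xs ! 0, xs ! Suc ?s}"
    using nth_rev_full[OF full, of t] nth_rev_full[OF full, of "n - 1"] s t
    by (simp add: insert_commute)
  then show ?thesis
    using full_types(3)[OF full s(2)] adjacent_last[OF full s(2)] hpos_rev[OF full t]
    unfolding ltype_def[of "rev xs"] hpos_def by auto
qed

lemma ltype_first: "full xs d i j \<Longrightarrow> ltype xs i 0"
  using full_wrap full_types(2)[of xs d i j 0] n_ge_4 unfolding ltype_def by force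

lemma last_types: "full xs d i j \<Longrightarrow> \<not> ltype xs i (n - 2) \<and> \<not> hpos xs (n - 2)"
  using ltype_first[OF full_rev] ltype_rev[of xs d i j 0] n_ge_4 by auto

text \<open>Adjacency of \<open>xs ! s\<close> and \<open>xs ! t\<close> can be read off after
  rotating at \<open>s\<close> and after rotating at \<open>t\<close>. The two readings look at
  different letters and must agree.\<close>

lemma ltype_pair:
  assumes "full xs d i j" "Suc s < t" "Suc t < n" "ltype xs i s" "ltype xs i t"
  shows "ltype xs i (Suc s) \<longleftrightarrow> ltype xs i (t - 1)"
proof -
  have "{xs ! s, xs ! t} \<in> G i \<longleftrightarrow> ltype xs i (t - 1)"
    using full_adjacency(2)[OF assms(1) _ assms(4), of "t - 1"]
      full_adjacency(4)[OF assms(1,3,5), of "t - 1"] assms(2,3) by auto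
  moreover have "{xs ! t, xs ! s} \<in> G i \<longleftrightarrow> ltype xs i (Suc s)"
    using full_adjacency(1)[OF assms(1,3,5), of s] assms(2,4) unfolding ltype_def by auto
  ultimately show ?thesis by (simp add: insert_commute)
qed

text \<open>The word of the path is \<open>a\<^sup>p h\<^sup>q b\<^sup>r\<close> with \<open>m = p + q\<close>.\<close>

definition block :: "'a list \<Rightarrow> nat \<Rightarrow> nat \<Rightarrow> nat \<Rightarrow> bool" where
  "block xs i p m \<longleftrightarrow> 0 < p \<and> p < m \<and> Suc m < n \<and>
     (\<forall>t. Suc t < n \<longrightarrow> (ltype xs i t \<longleftrightarrow> t < p) \<and> (hpos xs t \<longleftrightarrow> p \<le> t \<and> t < m))"

text \<open>The word of the path is a concatenation of words \<open>a h\<^sup>q b\<close>.\<close>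

definition alternating :: "'a list \<Rightarrow> nat \<Rightarrow> bool" where
  "alternating xs i \<longleftrightarrow>
     (\<forall>t. Suc (Suc t) < n \<longrightarrow> (ltype xs i (Suc t) \<longleftrightarrow> \<not> hpos xs t \<and> \<not> ltype xs i t))"

lemma uv_position:
  assumes "full xs d i j"
  obtains t where "Suc t < n" "{xs ! t, xs ! Suc t} = {u, v}"
proof -
  have "{u, v} \<in> path_edges xs"
    using assms unfolding full_def opt_def K_def by blast
  then show ?thesis
    using that full_length[OF assms] unfolding path_edges_def by fastforce
qed

lemma full_word:
  assumes full: "full xs d i j"
  shows "(\<exists>p m. block xs i p m) \<or> alternating xs i"
proof -
  let ?N = "n - 1"
  have "(\<exists>p m. \<forall>t<?N. (ltype xs i t \<longleftrightarrow> t < p) \<and> (hpos xs t \<longleftrightarrow> p \<le> t \<and> t < m)) \<or>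
    (\<forall>t. Suc t < ?N \<longrightarrow> (ltype xs i (Suc t) \<longleftrightarrow> \<not> hpos xs t \<and> \<not> ltype xs i t))"
  proof (rule word_structure)
    show "3 \<le> ?N" using n_ge_4 by simp
    show "ltype xs i 0" by (rule ltype_first[OF full])
    show "\<not> ltype xs i (?N - 1)" "\<not> hpos xs (?N - 1)"
      using last_types[OF full] by (auto simp: numeral_2_eq_2)
    show "\<not> hpos xs t" if "ltype xs i t" for t using ltype_not_hpos that .
    \<comment> \<open>Stated for every path, since the reversed path yields the corresponding
      condition on b.\<close>
    have hA: "\<not> ltype xs i (Suc t)" if "full xs d i j" "Suc t < ?N" "hpos xs t" for xs t
    proof -
      have "Suc (Suc t) < n" using that(2) by linarith
      then show ?thesis
        using full_adjacency(4)[OF that(1), of "Suc t" t] that(3) unfolding hpos_def by auto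
    qed
    show "\<not> ltype xs i (Suc t)" if "Suc t < ?N" "hpos xs t" for t
      using hA full that by blast
    show "\<not> hpos xs (Suc t)" if t: "Suc t < ?N" "\<not> hpos xs t" "\<not> ltype xs i t" for t
    proof -
      have "n - 2 - (n - 3 - t) = Suc t" "n - 2 - Suc (n - 3 - t) = t"
        "Suc (Suc (n - 3 - t)) < n" "Suc (n - 3 - t) < ?N" using t by auto
      then show ?thesis
        using hA[OF full_rev[OF full], of "n - 3 - t"] t
          hpos_rev[OF full, of "n - 3 - t"] ltype_rev[OF full, of "Suc (n - 3 - t)"] by auto
    qed
    show "ltype xs i (Suc s) \<longleftrightarrow> ltype xs i (t - 1)"
      if "Suc s < t" "t < ?N" "ltype xs i s" "ltype xs i t" for s t
      using ltype_pair[OF full] that by simp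
    show "\<not> ltype xs i (Suc s) \<and> \<not> hpos xs (Suc s) \<longleftrightarrow> \<not> ltype xs i (t - 1) \<and> \<not> hpos xs (t - 1)"
      if t: "Suc s < t" "t < ?N" "\<not> ltype xs i s" "\<not> hpos xs s" "\<not> ltype xs i t" "\<not> hpos xs t" for s t
    proof -
      let ?r = "\<lambda>t. n - 2 - t"
      have *: "?r (?r r) = r" "Suc (?r r) < n" if "r < ?N" for r using that by auto
      have l: "ltype (rev xs) i (?r r) \<longleftrightarrow> \<not> hpos xs r \<and> \<not> ltype xs i r" if "r < ?N" for r
        using ltype_rev[OF full *(2)[OF that]] *(1)[OF that] by simp
      have "Suc (?r t) < ?r s" "Suc (?r s) < n" "Suc (?r t) = ?r (t - 1)" "?r s - 1 = ?r (Suc s)"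
        using t by auto
      then have "ltype (rev xs) i (?r (t - 1)) \<longleftrightarrow> ltype (rev xs) i (?r (Suc s))"
        using ltype_pair[OF full_rev[OF full], of "?r t" "?r s"] l[of s] l[of t] t by simp
      then show ?thesis using l[of "t - 1"] l[of "Suc s"] t by auto
    qed
  qed
  then consider p m where "\<And>t. t < ?N \<Longrightarrow> (ltype xs i t \<longleftrightarrow> t < p) \<and> (hpos xs t \<longleftrightarrow> p \<le> t \<and> t < m)"
    | "alternating xs i" unfolding alternating_def by (auto simp: less_diff_conv)
  then show ?thesis
  proof cases
    case (1 p m)
    \<comment> \<open>The edge \<open>uv\<close> is itself a letter h, so the middle block is not
      empty.\<close>
    obtain t where t: "Suc t < n" "{xs ! t, xs ! Suc t} = {u, v}" using uv_position[OF full] .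
    then have "hpos xs t" unfolding hpos_def K_def by simp
    have "0 < p" using 1[of 0] ltype_first[OF full] n_ge_4 by auto
    moreover have "p < m" using 1[of t] t(1) \<open>hpos xs t\<close> by linarith
    moreover have "m \<le> n - 2" using 1[of "n - 2"] last_types[OF full] n_ge_4 by linarith
    ultimately have "block xs i p m" using 1 n_ge_4 unfolding block_def by auto
    then show ?thesis by blast
  qed blast
qed

section \<open>Block words and separation\<close>

text \<open>The n - 1 - m letters b become the leading letters a.\<close>

lemma block_rev:
  assumes full: "full xs d i j" and b: "block xs i p m"
  shows "block (rev xs) i (n - 1 - m) (n - 1 - p)"
proof -
  have "(ltype (rev xs) i t \<longleftrightarrow> t < n - 1 - m) \<and> (hpos (rev xs) t \<longleftrightarrow> n - 1 - m \<le> t \<and> t < n - 1 - p)"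
    if t: "Suc t < n" for t
  proof -
    have s: "Suc (n - 2 - t) < n" using t by auto
    have "ltype xs i (n - 2 - t) \<longleftrightarrow> n - 2 - t < p" "hpos xs (n - 2 - t) \<longleftrightarrow> p \<le> n - 2 - t \<and> n - 2 - t < m"
      "p < m" "Suc m < n"
      using b s unfolding block_def by auto
    then show ?thesis
      unfolding ltype_rev[OF full t] hpos_rev[OF full t] using t by auto
  qed
  moreover have "0 < n - 1 - m" "n - 1 - m < n - 1 - p" "Suc (n - 1 - p) < n"
    using b unfolding block_def by auto
  ultimately show ?thesis unfolding block_def by blast
qed

text \<open>A rotation inside the leading block only permutes vertices that are not adjacent to the
  last vertex, and all later edges stay put.\<close>

lemma block_rot:
  assumes full: "full xs d i j" and b: "block xs i p m" and t: "t < p"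
    and zs: "full (rot t xs) d' j l"
  shows "block (rot t xs) j p m"
proof -
  have nth: "rot t xs ! s = (if s \<le> t then xs ! (t - s) else xs ! s)" if "s < n" for s
    using nth_rot[of t xs s] full_length[OF full] b t that unfolding block_def by simp
  have bl: "ltype xs j s \<longleftrightarrow> s < p" "hpos xs s \<longleftrightarrow> p \<le> s \<and> s < m" if "Suc s < n" for s
    using b ltype_commute[OF full that] that unfolding block_def by auto
  have pm: "0 < p" "p < m" "Suc m < n" using b unfolding block_def by auto
  have "(ltype (rot t xs) j s \<longleftrightarrow> s < p) \<and> (hpos (rot t xs) s \<longleftrightarrow> p \<le> s \<and> s < m)"
    if s: "Suc s < n" for s
  proof (cases "s \<le> t")
    case True
    have last: "rot t xs ! (n - 1) = xs ! (n - 1)" using nth[of "n - 1"] t pm by auto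
    have "ltype xs j (t - s)" using bl[of "t - s"] True t pm by auto
    then have "{rot t xs ! s, rot t xs ! (n - 1)} \<notin> G j"
      using nth[of s] True s unfolding last ltype_def by auto
    then have "ltype (rot t xs) j s" using adjacent_last[OF zs s] by simp
    then show ?thesis using True t ltype_not_hpos by auto
  next
    case False
    have "rot t xs ! s = xs ! s" "rot t xs ! Suc s = xs ! Suc s" "rot t xs ! (n - 1) = xs ! (n - 1)"
      using nth[of s] nth[of "Suc s"] nth[of "n - 1"] s False by auto
    then show ?thesis using bl[OF s] unfolding ltype_def hpos_def by simp
  qed
  then show ?thesis using pm unfolding block_def by blast
qed

lemma image_nth_rot:
  assumes "t < p" "p < length xs"
  shows "(!) (rot t xs) ` {..<p} = (!) xs ` {..<p}"
    and "m \<ge> p \<Longrightarrow> (!) (rot t xs) ` {m..<length xs} = (!) xs ` {m..<length xs}"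
proof -
  note nth = nth_rot[of t xs]
  show "(!) (rot t xs) ` {..<p} = (!) xs ` {..<p}"
  proof (intro equalityI subsetI)
    fix z assume "z \<in> (!) (rot t xs) ` {..<p}"
    then show "z \<in> (!) xs ` {..<p}" using nth assms by auto
  next
    fix z assume "z \<in> (!) xs ` {..<p}"
    then obtain s where s: "s < p" "z = xs ! s" by auto
    then have "z = rot t xs ! (if s \<le> t then t - s else s)" using nth assms by auto
    then show "z \<in> (!) (rot t xs) ` {..<p}" using s assms(1) by auto
  qed
  show "(!) (rot t xs) ` {m..<length xs} = (!) xs ` {m..<length xs}" if "m \<ge> p"
    using nth assms that by (intro image_cong) auto
qed

text \<open>The demands of (C2) on a single colour. The set \<open>V - X - Y\<close> will turn out
  to be the vertex set of \<open>H\<close>; this form is symmetric in \<open>X\<close> and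
  \<open>Y\<close>.\<close>

definition separated :: "nat \<Rightarrow> 'a set \<Rightarrow> 'a set \<Rightarrow> bool" where
  "separated i X Y \<longleftrightarrow> clique (G i) X \<and> clique (G i) Y \<and> edges_between (G i) X Y = {} \<and>
     (\<forall>w \<in> V - X - Y. \<forall>z \<in> X \<union> Y. {w, z} \<in> G i)"

lemma separated_commute: "separated i X Y \<Longrightarrow> separated i Y X"
proof -
  have "edges_between (G i) X Y = edges_between (G i) Y X"
    unfolding edges_between_def by (auto simp: insert_commute)
  then show "separated i X Y \<Longrightarrow> separated i Y X"
    unfolding separated_def by (simp add: Un_commute Diff_eq Int_ac)
qed

text \<open>The letters a and h fill exactly the positions below \<open>m\<close>. For
  \<open>r > Suc s\<close>, \<open>full_adjacency\<close> asks for such a letter just before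
  \<open>xs ! r\<close>; vertices to the left are reached through the leading letters a.\<close>

lemma block_left:
  assumes full: "full xs d i j" and b: "block xs i p m" and s: "s < p" and r: "r < n" "r \<noteq> s"
  shows "{xs ! s, xs ! r} \<in> G i \<longleftrightarrow> r \<le> m"
proof -
  have bl: "ltype xs i t \<longleftrightarrow> t < p" "{xs ! t, xs ! Suc t} \<in> K \<longleftrightarrow> p \<le> t \<and> t < m" if "Suc t < n" for t
    using b that unfolding block_def hpos_def by auto
  have pm: "p < m" "Suc m < n" "Suc s < n" using b s unfolding block_def by auto
  have A: "ltype xs i s" using bl pm s by simp
  note adj = full_adjacency[OF full pm(3) A]
  consider "r < s" | "r = Suc s" | q where "r = Suc q" "s < q" using r(2)
    by (metis less_SucE linorder_neqE_nat not0_implies_Suc not_less_zero)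
  then show ?thesis
  proof cases
    case 1
    then show ?thesis using adj(1)[of r] bl[of "Suc r"] s pm by auto
  next
    case 2
    then show ?thesis using adj(3) s pm by auto
  next
    case (3 q)
    then show ?thesis using adj(2)[of q] bl[of q] r(1) pm by auto
  qed
qed

lemma block_right:
  assumes full: "full xs d i j" and b: "block xs i p m" and s: "m < s" "s < n" and r: "r < n" "r \<noteq> s"
  shows "{xs ! s, xs ! r} \<in> G i \<longleftrightarrow> p \<le> r"
proof -
  have "p < n" using b unfolding block_def by auto
  then have "n - 1 - s < n - 1 - m" "n - 1 - r \<noteq> n - 1 - s" "n - 1 - r < n"
    "n - 1 - (n - 1 - s) = s" "n - 1 - (n - 1 - r) = r" "n - 1 - r \<le> n - 1 - p \<longleftrightarrow> p \<le> r"
    using s r by auto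
  then show ?thesis
    using block_left[OF full_rev[OF full] block_rev[OF full b], of "n - 1 - s" "n - 1 - r"]
      nth_rev_full[OF full, of "n - 1 - s"] nth_rev_full[OF full, of "n - 1 - r"] s r by simp
qed

lemma block_separated:
  assumes full: "full xs d i j" and b: "block xs i p m"
  shows "separated i ((!) xs ` {..<p}) ((!) xs ` {Suc m..<n})"
proof -
  let ?X = "(!) xs ` {..<p}" and ?Y = "(!) xs ` {Suc m..<n}"
  note L = block_left[OF full b] and R = block_right[OF full b]
  have pm: "p < m" "Suc m < n" using b unfolding block_def by auto
  have "clique (G i) ?X"
    unfolding clique_def
  proof (clarsimp, goal_cases)
    case (1 s r)
    moreover from this have "r \<noteq> s" "r < n" "r \<le> m" using pm by auto
    ultimately show ?case using L[of s r] by simp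
  qed
  moreover have "clique (G i) ?Y"
    unfolding clique_def
  proof (clarsimp, goal_cases)
    case (1 s r)
    moreover from this have "r \<noteq> s" "p \<le> r" "m < s" using pm by auto
    ultimately show ?case using R[of s r] by simp
  qed
  moreover have "edges_between (G i) ?X ?Y = {}"
  proof -
    have "{xs ! s, xs ! r} \<notin> G i" if "s < p" "Suc m \<le> r" "r < n" for s r
      using L[of s r] that pm by auto
    then show ?thesis unfolding edges_between_def by auto
  qed
  moreover have "{w, z} \<in> G i" if w: "w \<in> V - ?X - ?Y" and z: "z \<in> ?X \<union> ?Y" for w z
  proof -
    obtain r where r: "r < n" "w = xs ! r"
      using w full_set[OF full] full_length[OF full] by (auto simp: in_set_conv_nth)
    then have "p \<le> r" "r \<le> m" using w by auto
    moreover obtain s where "z = xs ! s" "s < p \<or> m < s \<and> s < n" using z by auto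
    ultimately have "{z, w} \<in> G i" using r L[of s r] R[of s r] by auto
    then show ?thesis by (simp add: insert_commute)
  qed
  ultimately show ?thesis unfolding separated_def by blast
qed

text \<open>A rotation at the edge releases its colour, and the rotated path has the same vertex
  sets before and after the middle block.\<close>

lemma block_separated_left:
  assumes full: "full xs d i j" and b: "block xs i p m" and t: "t < p"
  shows "separated (d {xs ! t, xs ! Suc t}) ((!) xs ` {..<p}) ((!) xs ` {Suc m..<n})"
proof -
  have pm: "p < m" "Suc m < n" using b unfolding block_def by auto
  then have A: "ltype xs i t" using b t unfolding block_def by simp
  have t': "Suc t < n" using t pm by simp
  have "{xs ! 0, xs ! Suc t} \<in> G i" "{xs ! t, xs ! Suc t} \<notin> K"
    using A full_types(3)[OF full t'] unfolding ltype_def by auto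
  then obtain d' where zs: "full (rot t xs) d' j (d {xs ! t, xs ! Suc t})"
    using full_rotate[OF full t'] by blast
  have bz: "block (rot t xs) j p m" by (rule block_rot[OF full b t zs])
  then have "block (rot t xs) (d {xs ! t, xs ! Suc t}) p m"
    using ltype_commute[OF zs] unfolding block_def by simp
  from block_separated[OF full_commute[OF zs] this] show ?thesis
    using image_nth_rot[OF t, of xs] full_length[OF full] pm by simp
qed

text \<open>The n - 2 coloured edges have distinct colours, so together with \<open>i\<close> and
  \<open>j\<close> they account for all n colours. Any other colour that \<open>H\<close> does not
  use sits on an edge outside \<open>K\<close>, where a rotation can release it.\<close>

lemma full_colours:
  assumes full: "full xs d i j" and l: "l \<in> {1..n} - c ` H"
  shows "l = i \<or> l = j \<or> (\<exists>t. Suc t < n \<and> \<not> hpos xs t \<and> l = d {xs ! t, xs ! Suc t})"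
proof -
  define F where "F = path_edges xs - {{u, v}}"
  have opt: "opt xs F d" and ij: "i \<noteq> j" "i \<in> {1..n} - d ` F" "j \<in> {1..n} - d ` F"
    using full unfolding full_def F_def by auto
  have F: "inj_on d F" "d ` F \<subseteq> {1..n}" "\<forall>e\<in>H. d e = c e" "{u, v} \<in> path_edges xs"
    using opt unfolding opt_def state_def rainbow_def K_def by auto
  have "card F = n - 2"
    using F(4) card_path_edges[OF full_distinct[OF full]] full_length[OF full]
    unfolding F_def by (subst card_Diff_singleton) auto
  then have "card (insert i (insert j (d ` F))) = n"
    using ij F(1) n_ge_4 opt_finite[OF opt] by (simp add: card_image)
  moreover have "insert i (insert j (d ` F)) \<subseteq> {1..n}" using F(2) ij by auto
  ultimately have "insert i (insert j (d ` F)) = {1..n}" by (intro card_subset_eq) auto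
  then have "l = i \<or> l = j \<or> l \<in> d ` F" using l by blast
  moreover have "\<exists>t. Suc t < n \<and> \<not> hpos xs t \<and> l = d {xs ! t, xs ! Suc t}" if lF: "l \<in> d ` F"
  proof -
    obtain e where e: "e \<in> F" "l = d e" using lF by blast
    then have "e \<notin> K" using l F(3) unfolding F_def K_def by auto
    moreover obtain t where "Suc t < n" "e = {xs ! t, xs ! Suc t}"
      using e(1) full_length[OF full] unfolding F_def path_edges_def by auto
    ultimately show ?thesis using e(2) unfolding hpos_def by blast
  qed
  ultimately show ?thesis by blast
qed

lemma block_separated_all:
  assumes full: "full xs d i j" and b: "block xs i p m" and l: "l \<in> {1..n} - c ` H"
  shows "separated l ((!) xs ` {..<p}) ((!) xs ` {Suc m..<n})"
proof -
  consider "l = i" | "l = j" | t where "Suc t < n" "\<not> hpos xs t" "l = d {xs ! t, xs ! Suc t}"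
    using full_colours[OF full l] by blast
  then show ?thesis
  proof cases
    case 1
    then show ?thesis using block_separated[OF full b] by simp
  next
    case 2
    have "block xs j p m" using b ltype_commute[OF full] unfolding block_def by simp
    then show ?thesis using block_separated[OF full_commute[OF full]] 2 by simp
  next
    case (3 t)
    have pm: "p < m" "Suc m < n" using b unfolding block_def by auto
    show ?thesis
    proof (cases "t < p")
      case True
      then show ?thesis using block_separated_left[OF full b] 3 by simp
    next
      case False
      \<comment> \<open>The letter is b, so the path is rotated from its other end; there the two
        vertex sets swap roles.\<close>
      then have "m \<le> t" using b 3 unfolding block_def by auto
      then have t: "n - 2 - t < n - 1 - m" "Suc (n - 2 - t) = n - 1 - t" using 3(1) by auto
      have edge: "{rev xs ! (n - 2 - t), rev xs ! Suc (n - 2 - t)} = {xs ! t, xs ! Suc t}"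
        using nth_rev_full[OF full, of "n - 2 - t"] nth_rev_full[OF full, of "n - 1 - t"] 3(1)
        unfolding t(2) by (auto simp: Suc_diff_Suc numeral_2_eq_2)
      have img: "(!) (rev xs) ` S = (!) xs ` (\<lambda>t. n - 1 - t) ` S" if "S \<subseteq> {..<n}" for S
        unfolding image_image using that nth_rev_full[OF full] by (intro image_cong) auto
      have "(\<lambda>t. n - 1 - t) ` {..<n - 1 - m} = {Suc m..<n}"
      proof (intro equalityI subsetI)
        fix s assume "s \<in> {Suc m..<n}"
        then show "s \<in> (\<lambda>t. n - 1 - t) ` {..<n - 1 - m}"
          by (intro image_eqI[of _ _ "n - 1 - s"]) auto
      qed auto
      moreover have "(\<lambda>t. n - 1 - t) ` {Suc (n - 1 - p)..<n} = {..<p}"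
      proof (intro equalityI subsetI)
        fix s assume "s \<in> {..<p}"
        then show "s \<in> (\<lambda>t. n - 1 - t) ` {Suc (n - 1 - p)..<n}"
          using pm by (intro image_eqI[of _ _ "n - 1 - s"]) auto
      qed (use pm in auto)
      moreover have "{..<n - 1 - m} \<subseteq> {..<n}" "{Suc (n - 1 - p)..<n} \<subseteq> {..<n}" by auto
      ultimately have images: "(!) (rev xs) ` {..<n - 1 - m} = (!) xs ` {Suc m..<n}"
        "(!) (rev xs) ` {Suc (n - 1 - p)..<n} = (!) xs ` {..<p}"
        using img by metis+
      show ?thesis
        using block_separated_left[OF full_rev[OF full] block_rev[OF full b] t(1)]
        unfolding edge images 3(3) by (rule separated_commute)
    qed
  qed
qed

section \<open>Alternating words and independent sets\<close>

text \<open>\<open>Y\<close> is independent and completely joined to the rest of \<open>V\<close>.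
  Written through neighbourhoods, so that a single vertex of \<open>Y\<close> determines the whole
  set.\<close>

definition co_split :: "nat \<Rightarrow> 'a set \<Rightarrow> bool" where
  "co_split i Y \<longleftrightarrow> Y \<subseteq> V \<and> (\<forall>a\<in>Y. \<forall>z\<in>V. {a, z} \<in> G i \<longleftrightarrow> z \<notin> Y)"

lemma co_split_eq: "co_split i Y \<Longrightarrow> a \<in> Y \<Longrightarrow> Y = {z \<in> V. {a, z} \<notin> G i}"
  unfolding co_split_def by auto

lemma full_free: "full xs d i j \<Longrightarrow> i \<in> {1..n}" "full xs d i j \<Longrightarrow> j \<in> {1..n}"
  unfolding full_def by auto

lemma full_no_loop: "full xs d i j \<Longrightarrow> {z, z} \<notin> G i"
  using simple_graph_no_loop[OF simple_G] full_free(1) by blast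

lemma full_vertex:
  assumes "full xs d i j" "z \<in> V"
  obtains r where "r < n" "z = xs ! r"
  using assms full_set[OF assms(1)] full_length[OF assms(1)] by (metis in_set_conv_nth)

lemma last_neighbours:
  assumes "full xs d i j" "z \<in> V"
  shows "{xs ! (n - 1), z} \<in> G i \<longleftrightarrow> {xs ! (n - 1), z} \<in> G j"
proof -
  obtain r where r: "r < n" "z = xs ! r" using full_vertex[OF assms] .
  then consider "r = n - 1" | "Suc r < n" by linarith
  then show ?thesis
  proof cases
    case 1
    then show ?thesis
      using r full_no_loop[OF assms(1)] full_no_loop[OF full_commute[OF assms(1)]] by simp
  next
    case 2
    then show ?thesis
      using r full_types(4)[OF assms(1), of r] by (simp add: insert_commute)
  qed
qed

text \<open>In an alternating word, \<open>xs ! Suc t\<close> belongs to the set precisely when the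
  letter before it is b. This turns the descriptions in \<open>full_adjacency\<close>, for vertices
  on either side, into nonmembership.\<close>

lemma alternating_co_split:
  assumes full: "full xs d i j" and alt: "alternating xs i"
  shows "\<exists>Y. co_split i Y \<and> xs ! 0 \<in> Y \<and> xs ! (n - 1) \<in> Y \<and>
    (\<forall>t. Suc t < n \<and> hpos xs t \<longrightarrow> xs ! t \<notin> Y \<and> xs ! Suc t \<notin> Y)"
proof -
  \<comment> \<open>Positions where a letter a starts, and the final vertex, where no letter
    starts.\<close>
  define I where "I r \<longleftrightarrow> r = n - 1 \<or> ltype xs i r" for r
  define Y where "Y = (!) xs ` {r. r < n \<and> I r}"
  have len: "length xs = n" using full_length[OF full] .
  have Y: "xs ! r \<in> Y \<longleftrightarrow> I r" if "r < n" for r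
    using that full_distinct[OF full] len unfolding Y_def by (auto simp: nth_eq_iff_index_eq)
  have alt': "ltype xs i (Suc t) \<longleftrightarrow> \<not> hpos xs t \<and> \<not> ltype xs i t" if "Suc (Suc t) < n" for t
    using alt that unfolding alternating_def by blast
  \<comment> \<open>The recurrence extends to the final position because the last letter is
    b.\<close>
  have I_Suc: "I (Suc t) \<longleftrightarrow> \<not> hpos xs t \<and> \<not> ltype xs i t" if "Suc t < n" for t
  proof (cases "Suc t = n - 1")
    case True
    then have "t = n - 2" by simp
    then show ?thesis using last_types[OF full] True unfolding I_def by simp
  next
    case False
    then show ?thesis using alt'[of t] that unfolding I_def by auto
  qed
  have adj: "{xs ! a, xs ! r} \<in> G i \<longleftrightarrow> \<not> I r" if a: "I a" "a < n" and r: "r < n" for a r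
  proof (cases "a = r")
    case True
    then show ?thesis using full_no_loop[OF full] a by simp
  next
    case ar: False
    show ?thesis
    proof (cases "a = n - 1")
      case True
      then have "Suc r < n" "r \<noteq> n - 1" using ar r by auto
      then show ?thesis
        using adjacent_last[OF full, of r] True unfolding I_def by (simp add: insert_commute)
    next
      case False
      then have A: "ltype xs i a" "Suc a < n" using a unfolding I_def by auto
      note adj = full_adjacency[OF full A(2,1), folded hpos_def]
      consider "r < a" | "r = Suc a" | q where "r = Suc q" "a < q" using ar
        by (metis less_SucE linorder_neqE_nat not0_implies_Suc not_less_zero)
      then show ?thesis
      proof cases
        case 1
        then show ?thesis
          using adj(1)[of r] alt'[of r] A ltype_not_hpos[of xs i r] unfolding I_def by auto
      next
        case 2
        then show ?thesis using adj(3) I_Suc[of a] A by simp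
      next
        case (3 q)
        then show ?thesis using adj(2)[of q] I_Suc[of q] r by auto
      qed
    qed
  qed
  have "co_split i Y"
    unfolding co_split_def
  proof (intro conjI ballI)
    show "Y \<subseteq> V" using full_set[OF full] len unfolding Y_def by auto
    fix a z assume "a \<in> Y" "z \<in> V"
    moreover obtain r where "r < n" "z = xs ! r" using full_vertex[OF full \<open>z \<in> V\<close>] .
    ultimately show "{a, z} \<in> G i \<longleftrightarrow> z \<notin> Y" using adj Y unfolding Y_def by blast
  qed
  moreover have "xs ! 0 \<in> Y" "xs ! (n - 1) \<in> Y"
    using Y ltype_first[OF full] n_ge_4 unfolding I_def by auto
  moreover have "xs ! t \<notin> Y" "xs ! Suc t \<notin> Y" if "Suc t < n" "hpos xs t" for t
    using Y[of t] Y[of "Suc t"] that I_Suc[of t] ltype_not_hpos[of xs i t] unfolding I_def by auto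
  ultimately show ?thesis by blast
qed

text \<open>The rotation releases the colour and keeps the last vertex. The set obtained from the
  rotated path contains that vertex and so is its set of non-neighbours. Assumption
  \<open>alt\<close> ranges over all paths in order to cover the rotated one.\<close>

lemma alternating_left:
  assumes alt: "\<And>xs d i j. full xs d i j \<Longrightarrow> alternating xs i"
    and full: "full xs d i j" and Y: "co_split i Y" "xs ! (n - 1) \<in> Y"
    and t: "Suc t < n" "ltype xs i t"
  shows "co_split (d {xs ! t, xs ! Suc t}) Y"
proof -
  let ?l = "d {xs ! t, xs ! Suc t}" and ?y = "xs ! (n - 1)"
  have "{xs ! 0, xs ! Suc t} \<in> G i" "{xs ! t, xs ! Suc t} \<notin> K"
    using t full_types(3)[OF full t(1)] unfolding ltype_def by auto
  then obtain d' where zs: "full (rot t xs) d' j ?l"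
    using full_rotate[OF full t(1)] by blast
  have y: "rot t xs ! (n - 1) = ?y"
  proof -
    have "\<not> n - 1 \<le> t" "n - 1 < n" using t(1) by linarith+
    then show ?thesis using nth_rot[of t xs "n - 1"] full_length[OF full] t(1) by simp
  qed
  have sp: "full (rot t xs) d' ?l j" using full_commute[OF zs] .
  obtain Y' where Y': "co_split ?l Y'" "?y \<in> Y'"
    using alternating_co_split[OF sp alt[OF sp]] unfolding y by blast
  have "Y' = {z \<in> V. {?y, z} \<notin> G ?l}" by (rule co_split_eq[OF Y'])
  also have "\<dots> = {z \<in> V. {?y, z} \<notin> G j}"
    using last_neighbours[OF zs] unfolding y by blast
  also have "\<dots> = {z \<in> V. {?y, z} \<notin> G i}"
    using last_neighbours[OF full] by blast
  also have "\<dots> = Y" by (rule co_split_eq[OF Y, symmetric])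
  finally show ?thesis using Y' by simp
qed

lemma alternating_other:
  assumes alt: "\<And>xs d i j. full xs d i j \<Longrightarrow> alternating xs i"
    and full: "full xs d i j" and Y: "co_split i Y" "xs ! (n - 1) \<in> Y"
  shows "co_split j Y"
proof -
  let ?y = "xs ! (n - 1)"
  note full' = full_commute[OF full]
  obtain Y' where Y': "co_split j Y'" "?y \<in> Y'"
    using alternating_co_split[OF full' alt[OF full']] by blast
  have "Y' = {z \<in> V. {?y, z} \<notin> G j}" by (rule co_split_eq[OF Y'])
  also have "\<dots> = {z \<in> V. {?y, z} \<notin> G i}"
    using last_neighbours[OF full] by blast
  also have "\<dots> = Y" by (rule co_split_eq[OF Y, symmetric])
  finally show ?thesis using Y' by simp
qed

lemma alternating_all:
  assumes alt: "\<And>xs d i j. full xs d i j \<Longrightarrow> alternating xs i"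
    and full: "full xs d i j" and Y: "co_split i Y" "xs ! 0 \<in> Y" "xs ! (n - 1) \<in> Y"
    and l: "l \<in> {1..n} - c ` H"
  shows "co_split l Y"
proof -
  consider "l = i" | "l = j" | t where "Suc t < n" "\<not> hpos xs t" "l = d {xs ! t, xs ! Suc t}"
    using full_colours[OF full l] by blast
  then show ?thesis
  proof cases
    case 2
    then show ?thesis using alternating_other[OF alt full Y(1,3)] by simp
  next
    case (3 t)
    show ?thesis
    proof (cases "ltype xs i t")
      case True
      then show ?thesis using alternating_left[OF alt full Y(1,3)] 3 by simp
    next
      case False
      \<comment> \<open>A letter b is a letter a of the reversed path, whose last vertex is the old
        first vertex and again lies in \<open>Y\<close>.\<close>
      have s: "Suc (n - 2 - t) < n" "Suc (n - 2 - t) = n - 1 - t" "n - 2 - (n - 2 - t) = t"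
        using 3(1) by auto
      have "ltype (rev xs) i (n - 2 - t)"
        using ltype_rev[OF full s(1)] 3(2) False unfolding s(3) by simp
      moreover have "rev xs ! (n - 1) \<in> Y"
        using Y(2) nth_rev_full[OF full, of "n - 1"] n_ge_4 by simp
      moreover have "{rev xs ! (n - 2 - t), rev xs ! Suc (n - 2 - t)} = {xs ! t, xs ! Suc t}"
        using nth_rev_full[OF full, of "n - 2 - t"] nth_rev_full[OF full, of "n - 1 - t"] 3(1)
        unfolding s(2) by (auto simp: Suc_diff_Suc numeral_2_eq_2)
      ultimately show ?thesis
        using alternating_left[OF alt full_rev[OF full] Y(1) _ s(1)] 3(3) by simp
    qed
  qed (use Y in simp)
qed

text \<open>Both ends of the path lie in \<open>Y\<close>, hence have degree
  \<open>card (V - Y)\<close> in either colour, and the tight Ore count makes these two degrees add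
  up to n + k.\<close>

lemma card_co_split:
  assumes full: "full xs d i j" and Y: "co_split i Y" "co_split j Y" "xs ! 0 \<in> Y" "xs ! (n - 1) \<in> Y"
  shows "2 * card (V - Y) = n + k"
proof -
  have deg: "degree (G l) a = card (V - Y)" if "l \<in> {1..n}" "co_split l Y" "a \<in> Y" for l a
  proof -
    have "a \<in> V" "{z \<in> V. {a, z} \<in> G l} = V - Y" using that unfolding co_split_def by auto
    then show ?thesis using degree_eq_card_neighbours[OF simple_G[OF that(1)]] by simp
  qed
  have "degree (G i) (xs ! 0) + degree (G j) (xs ! (n - 1)) = n + k"
    using full opt_types(1) unfolding full_def by blast
  then show ?thesis using deg full_free[OF full] Y by simp
qed

section \<open>Reading off (C2) and (C3)\<close>

lemma verts_with_K: "verts_with H u v = \<Union>K"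
  unfolding verts_with_def K_def by auto

lemma Union_K:
  assumes "full xs d i j"
  shows "\<Union>K = (\<Union>t\<in>{t. Suc t < n \<and> hpos xs t}. {xs ! t, xs ! Suc t})"
proof -
  have "K = {{xs ! t, xs ! Suc t} | t. Suc t < n \<and> hpos xs t}"
    using assms full_length[OF assms] unfolding full_def opt_def hpos_def path_edges_def by auto
  then show ?thesis by blast
qed

lemma alternating_conclusion:
  assumes alt: "\<And>xs d i j. full xs d i j \<Longrightarrow> alternating xs i" and full: "full xs d i j"
  shows "\<exists>X Y. partition2 V X Y \<and>
      real (card X) = (real n + real k) / 2 \<and> real (card Y) = (real n - real k) / 2 \<and>
      verts_with H u v \<subseteq> X \<and>
      (\<forall>i \<in> {1..n} - c ` H. complete_bipartite X Y (edges_between (G i) X Y) \<and> independent_set (G i) Y)"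
proof -
  obtain Y where Y: "co_split i Y" "xs ! 0 \<in> Y" "xs ! (n - 1) \<in> Y"
    and h: "\<And>t. Suc t < n \<Longrightarrow> hpos xs t \<Longrightarrow> xs ! t \<notin> Y \<and> xs ! Suc t \<notin> Y"
    using alternating_co_split[OF full alt[OF full]] by blast
  have YV: "Y \<subseteq> V" using Y unfolding co_split_def by blast
  have card: "2 * card (V - Y) = n + k"
    using card_co_split[OF full Y(1) alternating_other[OF alt full Y(1,3)] Y(2,3)] .
  moreover have "card (V - Y) + card Y = n"
    using YV finite_V card_V by (metis card_Diff_subset card_mono finite_subset le_add_diff_inverse2)
  ultimately have "real (card (V - Y)) = (real n + real k) / 2" "real (card Y) = (real n - real k) / 2"
    by (simp_all add: field_simps)
  moreover have "partition2 V (V - Y) Y" using YV unfolding partition2_def by blast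
  moreover have "verts_with H u v \<subseteq> V - Y"
    unfolding verts_with_K Union_K[OF full] using h full_set[OF full] full_length[OF full] by auto
  moreover have "complete_bipartite (V - Y) Y (edges_between (G l) (V - Y) Y) \<and> independent_set (G l) Y"
    if "l \<in> {1..n} - c ` H" for l
  proof -
    have "co_split l Y" using alternating_all[OF alt full Y that] .
    then have adj: "{a, z} \<in> G l \<longleftrightarrow> z \<notin> Y" if "a \<in> Y" "z \<in> V" for a z
      using that unfolding co_split_def by blast
    have "{x, y} \<in> G l" if "x \<in> V - Y" "y \<in> Y" for x y
      using adj[of y x] that by (simp add: insert_commute)
    moreover have "independent_set (G l) Y" using adj YV unfolding independent_set_def by blast
    ultimately show ?thesis using complete_bipartite_edges_between by blast
  qed
  ultimately show ?thesis by blast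
qed

lemma component_eq_if_path:
  assumes "\<And>s. r \<le> s \<Longrightarrow> s < t \<Longrightarrow> {xs ! s, xs ! Suc s} \<in> H" "r \<le> t"
  shows "component W H (xs ! r) = component W H (xs ! t)"
proof -
  let ?R = "{(a, b). {a, b} \<in> H}"
  have "sym (?R\<^sup>*)" by (intro sym_rtrancl) (auto simp: sym_def insert_commute)
  moreover have "(xs ! r, xs ! t) \<in> ?R\<^sup>*"
    using assms(2,1) by (induction rule: dec_induct) (auto intro: rtrancl.rtrancl_into_rtrancl)
  ultimately show ?thesis
    unfolding component_def by (meson rtrancl_trans symD)
qed

text \<open>The edges of \<open>K\<close> form one contiguous segment of the path, from
  \<open>p\<close> to \<open>m\<close>. Removing \<open>uv\<close> from it leaves two subpaths, the
  components of \<open>u\<close> and \<open>v\<close>; the vertices before and after the segment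
  give the partition.\<close>

lemma block_conclusion:
  assumes full: "full xs d i j" and b: "block xs i p m"
  shows "components (verts_with H u v) H =
      {component (verts_with H u v) H u, component (verts_with H u v) H v} \<and>
    (\<exists>X Y. partition2 (V - verts_with H u v) X Y \<and> card X \<ge> 1 \<and> card Y \<ge> 1 \<and>
      (\<forall>i \<in> {1..n} - c ` H.
         clique (G i) X \<and> clique (G i) Y \<and> edges_between (G i) X Y = {} \<and>
         (\<forall>w \<in> verts_with H u v. \<forall>z \<in> X \<union> Y. {w, z} \<in> G i)))"
proof
  let ?W = "verts_with H u v" and ?X = "(!) xs ` {..<p}" and ?Y = "(!) xs ` {Suc m..<n}"
  have pm: "0 < p" "p < m" "Suc m < n"
    and h: "\<And>t. Suc t < n \<Longrightarrow> hpos xs t \<longleftrightarrow> p \<le> t \<and> t < m"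
    using b unfolding block_def by auto
  have len: "length xs = n" using full_length[OF full] .
  have hset: "{t. Suc t < n \<and> hpos xs t} = {p..<m}" using h pm by auto
  have W: "?W = (!) xs ` {p..m}"
  proof (intro equalityI subsetI)
    fix z assume "z \<in> (!) xs ` {p..m}"
    then obtain r where r: "p \<le> r" "r \<le> m" "z = xs ! r" by auto
    show "z \<in> ?W"
    proof (cases "r < m")
      case True
      then show ?thesis using r unfolding verts_with_K Union_K[OF full] hset by auto
    next
      case False
      then show ?thesis using r pm unfolding verts_with_K Union_K[OF full] hset
        by (intro UN_I[of "m - 1"]) auto
    qed
  qed (auto simp: verts_with_K Union_K[OF full] hset)
  obtain s where s: "Suc s < n" "{xs ! s, xs ! Suc s} = {u, v}" using uv_position[OF full] .
  then have "hpos xs s" unfolding hpos_def K_def by simp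
  then have ps: "p \<le> s" "s < m" using h s by auto
  have HE: "{xs ! r, xs ! Suc r} \<in> H" if "p \<le> r" "r < m" "r \<noteq> s" for r
  proof -
    have "r < length xs - 1" "s < length xs - 1" using that pm s(1) len by linarith+
    have "{xs ! r, xs ! Suc r} \<in> K" using h that pm unfolding hpos_def by auto
    moreover have "{xs ! r, xs ! Suc r} \<noteq> {u, v}"
      using inj_onD[OF inj_on_path_edge[OF full_distinct[OF full]], of r s] s(2) that(3)
        \<open>r < length xs - 1\<close> \<open>s < length xs - 1\<close> by auto
    ultimately show ?thesis unfolding K_def by blast
  qed
  have "component ?W H w \<in> {component ?W H u, component ?W H v}" if w: "w \<in> ?W" for w
  proof -
    obtain r where r: "p \<le> r" "r \<le> m" "w = xs ! r" using w W by auto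
    have "component ?W H w \<in> {component ?W H (xs ! s), component ?W H (xs ! Suc s)}"
    proof (cases "r \<le> s")
      case True
      then show ?thesis using component_eq_if_path[of r s xs] HE r ps by auto
    next
      case False
      then have "component ?W H (xs ! Suc s) = component ?W H (xs ! r)"
        using r ps by (intro component_eq_if_path HE) auto
      then show ?thesis using r by simp
    qed
    then show ?thesis using s(2) by (auto simp: doubleton_eq_iff)
  qed
  moreover have "u \<in> ?W" "v \<in> ?W" unfolding verts_with_def by auto
  ultimately show "components ?W H = {component ?W H u, component ?W H v}"
    unfolding components_def by blast
  have inj: "inj_on ((!) xs) {..<n}" using full_distinct[OF full] len by (auto simp: inj_on_def nth_eq_iff_index_eq)
  have V: "V = (!) xs ` {..<n}" using full_set[OF full] len by (auto simp: set_conv_nth)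
  have split: "{..<n} - {p..m} = {..<p} \<union> {Suc m..<n}" "{..<p} \<inter> {Suc m..<n} = {}"
    "{..<p} \<subseteq> {..<n}" "{Suc m..<n} \<subseteq> {..<n}" "{p..m} \<subseteq> {..<n}" using pm by auto
  have "V - ?W = ?X \<union> ?Y"
    unfolding V W image_Un[symmetric] split(1)[symmetric]
    using inj_on_image_set_diff[OF inj _ split(5), of "{..<n}"] by simp
  moreover have "?X \<inter> ?Y = {}"
    using inj_on_image_Int[OF inj split(3,4)] split(2) by simp
  ultimately have part: "partition2 (V - ?W) ?X ?Y" unfolding partition2_def by simp
  have WV: "?W \<subseteq> V - ?X - ?Y"
    using \<open>V - ?W = ?X \<union> ?Y\<close> split(5) unfolding W V by auto
  have "card ?X \<ge> 1" "card ?Y \<ge> 1"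
    using pm by (auto simp: Suc_le_eq card_gt_0_iff)
  moreover have "clique (G l) ?X \<and> clique (G l) ?Y \<and> edges_between (G l) ?X ?Y = {} \<and>
      (\<forall>w \<in> ?W. \<forall>z \<in> ?X \<union> ?Y. {w, z} \<in> G l)" if "l \<in> {1..n} - c ` H" for l
    using block_separated_all[OF full b that] WV unfolding separated_def by blast
  ultimately show "\<exists>X Y. partition2 (V - ?W) X Y \<and> card X \<ge> 1 \<and> card Y \<ge> 1 \<and>
      (\<forall>i \<in> {1..n} - c ` H.
         clique (G i) X \<and> clique (G i) Y \<and> edges_between (G i) X Y = {} \<and>
         (\<forall>w \<in> ?W. \<forall>z \<in> X \<union> Y. {w, z} \<in> G i))"
    using part by blast
qed

lemma extremal_structure:
  assumes xs: "distinct xs" "set xs = V" "insert {u, v} H \<subseteq> path_edges xs" and c: "rainbow n G H c"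
  shows "(components (verts_with H u v) H =
      {component (verts_with H u v) H u, component (verts_with H u v) H v} \<and>
    (\<exists>X Y. partition2 (V - verts_with H u v) X Y \<and> card X \<ge> 1 \<and> card Y \<ge> 1 \<and>
      (\<forall>i \<in> {1..n} - c ` H.
         clique (G i) X \<and> clique (G i) Y \<and> edges_between (G i) X Y = {} \<and>
         (\<forall>w \<in> verts_with H u v. \<forall>z \<in> X \<union> Y. {w, z} \<in> G i)))) \<or>
    (\<exists>X Y. partition2 V X Y \<and>
      real (card X) = (real n + real k) / 2 \<and> real (card Y) = (real n - real k) / 2 \<and>
      verts_with H u v \<subseteq> X \<and>
      (\<forall>i \<in> {1..n} - c ` H. complete_bipartite X Y (edges_between (G i) X Y) \<and> independent_set (G i) Y))"
proof -
  have "state xs H c"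
    \<comment> \<open>To start with, exactly the edges of \<open>H\<close> are coloured, by
      \<open>c\<close>.\<close>
    using xs c uv_notin_H unfolding state_def K_def cyc_edges_def by auto
  then obtain ys d i j where full: "full ys d i j" using full_exists by blast
  show ?thesis
  \<comment> \<open>The alternating case must hold for all paths at once, because colours are
    reached through rotated paths; a single block word suffices for (C2).\<close>
  proof (cases "\<exists>xs d i j p m. full xs d i j \<and> block xs i p m")
    case True
    then obtain xs d i j p m where "full xs d i j" "block xs i p m" by blast
    from block_conclusion[OF this] show ?thesis by (rule disjI1)
  next
    case False
    then have "alternating xs i" if "full xs d i j" for xs d i j using that full_word by blast
    from alternating_conclusion[OF this full] show ?thesis by (rule disjI2)
  qed
qed

end

section \<open>A Hamiltonian path through a linear forest\<close>

lemma path_edges_append_subset: "path_edges as \<union> path_edges bs \<subseteq> path_edges (as @ bs)"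
  by (cases "as = []"; cases "bs = []") (auto simp: path_edges_append)

lemma concat_paths:
  assumes "finite \<C>" "pairwise disjnt \<C>"
    and "\<And>C. C \<in> \<C> \<Longrightarrow> \<exists>xs. distinct xs \<and> set xs = C \<and> E C \<subseteq> path_edges xs"
  shows "\<exists>xs. distinct xs \<and> set xs = \<Union>\<C> \<and> (\<Union>C\<in>\<C>. E C) \<subseteq> path_edges xs"
  using assms
proof (induction rule: finite_induct)
  case empty
  then show ?case by (intro exI[of _ "[]"]) simp
next
  case (insert C \<C>)
  obtain ys where ys: "distinct ys" "set ys = \<Union>\<C>" "(\<Union>C\<in>\<C>. E C) \<subseteq> path_edges ys"
    using insert by (auto simp: pairwise_insert)
  obtain xs where xs: "distinct xs" "set xs = C" "E C \<subseteq> path_edges xs"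
    using insert.prems(2) by blast
  have "C \<inter> \<Union>\<C> = {}"
    using insert.prems(1) insert.hyps(2) by (auto simp: pairwise_insert disjnt_def)
  then show ?case
    using xs ys path_edges_append_subset[of xs ys] by (intro exI[of _ "xs @ ys"]) auto
qed

text \<open>An inner vertex of a path lies on two different edges of it.\<close>

lemma path_end_if_degree_le_1:
  assumes "distinct xs" "path_edges xs \<subseteq> H" "finite H" "w \<in> set xs" "degree H w \<le> 1"
  shows "hd xs = w \<or> last xs = w"
proof (rule ccontr)
  assume ends: "\<not> (hd xs = w \<or> last xs = w)"
  obtain i where i: "i < length xs" "w = xs ! i" using assms(4) by (auto simp: in_set_conv_nth)
  have ne: "xs \<noteq> []" using i by auto
  then have "i \<noteq> 0" "i \<noteq> length xs - 1"
    using ends i by (auto simp: hd_conv_nth last_conv_nth intro!: gr0I)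
  then obtain j where j: "i = Suc j" "Suc i < length xs" using i by (cases i) auto
  let ?e = "{xs ! j, xs ! i}" and ?f = "{xs ! i, xs ! Suc i}"
  have "?e \<noteq> ?f" using assms(1) j by (auto simp: doubleton_eq_iff nth_eq_iff_index_eq)
  moreover have "?e \<in> path_edges xs" "?f \<in> path_edges xs" using i j unfolding path_edges_def by auto
  ultimately have "{?e, ?f} \<subseteq> {e \<in> H. w \<in> e}" "card {?e, ?f} = 2" using assms(2) i by auto
  then show False
    using card_mono[of "{e \<in> H. w \<in> e}" "{?e, ?f}"] assms(3,5) unfolding degree_def by simp
qed

text \<open>The path of the component of \<open>u\<close> is arranged to end in \<open>u\<close> and
  is followed by that of \<open>v\<close> started at \<open>v\<close>, so the junction is the edge
  \<open>uv\<close>. Compatibility makes these two components disjoint and their degree bounds make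
  \<open>u\<close> and \<open>v\<close> ends. The other components and the remaining vertices follow
  in any order, as the graph is complete.\<close>

lemma hamiltonian_path_through_linear_forest:
  assumes fin: "finite V" and WV: "verts_with H u v \<subseteq> V"
    and lin: "linear_forest (verts_with H u v) H" and comp: "compatible H u v"
  shows "{u, v} \<notin> H" "\<exists>xs. distinct xs \<and> set xs = V \<and> insert {u, v} H \<subseteq> path_edges xs"
proof -
  define W where "W = verts_with H u v"
  let ?R = "{(a, b). {a, b} \<in> H}" and ?C = "component W H"
  have finW: "finite W" using finite_subset[OF WV fin] unfolding W_def .
  have simple: "H \<subseteq> {e. e \<subseteq> W \<and> card e = 2}"
    using lin unfolding linear_forest_def simple_graph_def W_def by simp
  then have finH: "finite H" using finW by (metis (no_types, lifting) Collect_mono_iff finite_Pow_iff Pow_def finite_subset)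
  have uvW: "u \<in> W" "v \<in> W" unfolding W_def verts_with_def by auto
  have sym: "sym (?R\<^sup>*)" by (intro sym_rtrancl) (auto simp: sym_def insert_commute)
  have eq: "?C a = ?C b" if "(a, b) \<in> ?R\<^sup>*" for a b
    using that sym unfolding component_def by (meson rtrancl_trans symD)
  have self: "a \<in> ?C a" if "a \<in> W" for a using that unfolding component_def by auto
  have uv: "?C u \<noteq> ?C v" using comp unfolding compatible_def W_def by simp
  then show "{u, v} \<notin> H" using eq[of u v] by auto
  have CW: "?C a \<subseteq> W" for a unfolding component_def by auto
  have disj: "?C a = ?C b" if "z \<in> ?C a" "z \<in> ?C b" for a b z
    using that eq[of a z] eq[of b z] unfolding component_def by auto
  have path: "\<exists>xs. xs \<noteq> [] \<and> distinct xs \<and> set xs = ?C a \<and> path_edges xs = {e \<in> H. e \<subseteq> ?C a}"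
    if "a \<in> W" for a
    using lin that unfolding linear_forest_def is_path_def components_def W_def by blast
  have last_path: "\<exists>xs. xs \<noteq> [] \<and> distinct xs \<and> set xs = ?C a \<and> path_edges xs = {e \<in> H. e \<subseteq> ?C a} \<and> last xs = a"
    if a: "a \<in> W" "degree H a \<le> 1" for a
  proof -
    obtain xs where xs: "xs \<noteq> []" "distinct xs" "set xs = ?C a" "path_edges xs = {e \<in> H. e \<subseteq> ?C a}"
      using path[OF a(1)] by blast
    have "hd xs = a \<or> last xs = a"
      using path_end_if_degree_le_1[OF xs(2) _ finH _ a(2)] xs self[OF a(1)] by auto
    then show ?thesis
    proof
      assume "hd xs = a"
      then show ?thesis using xs by (intro exI[of _ "rev xs"]) (auto simp: last_rev)
    qed (use xs in blast)
  qed
  have deg: "degree H u \<le> 1" "degree H v \<le> 1" using comp unfolding compatible_def by auto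
  obtain us where us: "us \<noteq> []" "distinct us" "set us = ?C u" "path_edges us = {e \<in> H. e \<subseteq> ?C u}" "last us = u"
    using last_path[OF uvW(1) deg(1)] by blast
  obtain vs where vs: "vs \<noteq> []" "distinct vs" "set vs = ?C v" "path_edges vs = {e \<in> H. e \<subseteq> ?C v}" "last vs = v"
    using last_path[OF uvW(2) deg(2)] by blast
  define \<C> where "\<C> = components W H - {?C u, ?C v}"
  have "\<exists>ws. distinct ws \<and> set ws = \<Union>\<C> \<and> (\<Union>C\<in>\<C>. {e \<in> H. e \<subseteq> C}) \<subseteq> path_edges ws"
  proof (rule concat_paths)
    show "finite \<C>" using finW unfolding \<C>_def components_def by simp
    show "pairwise disjnt \<C>"
    proof (rule pairwiseI)
      fix C D assume "C \<in> \<C>" "D \<in> \<C>" "C \<noteq> D"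
      then show "disjnt C D"
        unfolding \<C>_def components_def disjnt_def using disj by auto
    qed
    show "\<exists>xs. distinct xs \<and> set xs = C \<and> {e \<in> H. e \<subseteq> C} \<subseteq> path_edges xs" if C: "C \<in> \<C>" for C
    proof -
      obtain a where a: "a \<in> W" "C = ?C a" using C unfolding \<C>_def components_def by auto
      obtain xs where "distinct xs" "set xs = ?C a" "path_edges xs = {e \<in> H. e \<subseteq> ?C a}"
        using path[OF a(1)] by blast
      then show ?thesis unfolding a(2) by (intro exI[of _ xs]) simp
    qed
  qed
  then obtain ws where ws: "distinct ws" "set ws = \<Union>\<C>" "(\<Union>C\<in>\<C>. {e \<in> H. e \<subseteq> C}) \<subseteq> path_edges ws"
    by (elim exE conjE)
  obtain zs where zs: "distinct zs" "set zs = V - W"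
    using finite_distinct_list[of "V - W"] fin by auto
  let ?xs = "(us @ rev vs) @ (ws @ zs)"
  have "?C u \<inter> ?C v = {}"
  proof (rule ccontr)
    assume "\<not> ?thesis"
    then obtain z where "z \<in> ?C u" "z \<in> ?C v" by auto
    then show False using disj uv by simp
  qed
  moreover have "(?C u \<union> ?C v) \<inter> \<Union>\<C> = {}"
  proof (rule ccontr)
    assume "\<not> ?thesis"
    then obtain z C where "z \<in> ?C u \<or> z \<in> ?C v" "z \<in> C" "C \<in> \<C>" by auto
    then show False unfolding \<C>_def components_def using disj by auto
  qed
  moreover have "\<Union>\<C> \<subseteq> W" unfolding \<C>_def components_def using CW by auto
  ultimately have "distinct ?xs"
    using us(2,3) vs(2,3) ws(1,2) zs CW[of u] CW[of v] by auto
  moreover have "?C u \<union> ?C v \<union> \<Union>\<C> = W"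
  proof
    show "W \<subseteq> ?C u \<union> ?C v \<union> \<Union>\<C>" using self unfolding \<C>_def components_def by auto
  qed (use CW \<open>\<Union>\<C> \<subseteq> W\<close> in blast)
  then have "set ?xs = V" using us(3) vs(3) ws(2) zs(2) WV unfolding W_def[symmetric] by auto
  moreover have "insert {u, v} H \<subseteq> path_edges ?xs"
  proof -
    have sub: "path_edges (us @ rev vs) \<union> path_edges ws \<subseteq> path_edges ?xs"
      using path_edges_append_subset[of "us @ rev vs" "ws @ zs"] path_edges_append_subset[of ws zs] by blast
    have left: "path_edges (us @ rev vs) = insert {u, v} (path_edges us \<union> path_edges vs)"
      using us(1,5) vs(1,5) by (subst path_edges_append) (simp_all add: hd_rev)
    have "e \<in> path_edges us \<union> path_edges vs \<union> path_edges ws" if e: "e \<in> H" for e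
    proof -
      obtain a b where ab: "e = {a, b}" "a \<in> W" "b \<in> W" using simple e by (auto simp: card_2_iff)
      then have "e \<subseteq> ?C a" using self eq[of a b] e by auto
      moreover have "?C a = ?C u \<or> ?C a = ?C v \<or> ?C a \<in> \<C>" using ab unfolding \<C>_def components_def by auto
      ultimately show ?thesis using e us(4) vs(4) ws(3) by auto
    qed
    then have "H \<subseteq> path_edges us \<union> path_edges vs \<union> path_edges ws" by (rule subsetI)
    then show ?thesis using sub unfolding left by blast
  qed
  ultimately show "\<exists>xs. distinct xs \<and> set xs = V \<and> insert {u, v} H \<subseteq> path_edges xs" by blast
qed

theorem theorem1p8:
  fixes V :: "'a set" and G :: "nat \<Rightarrow> 'a set set" and H :: "'a set set"
    and c :: "'a set \<Rightarrow> nat" and k n :: nat and u v :: 'a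
  assumes "real k \<le> (real n - 4) / 3"
    and "finite V" and "card V = n"
    and "\<And>i. i \<in> {1..n} \<Longrightarrow> simple_graph V (G i)"
    and "\<And>i. i \<in> {1..n} \<Longrightarrow> sigma2 V (G i) \<ge> enat (n + k)"
    and "u \<in> V" and "v \<in> V" and "verts_with H u v \<subseteq> V"
    and "linear_forest (verts_with H u v) H" and "card H = k"
    and "rainbow n G H c"
    and "compatible H u v"
  shows
    "(\<exists>P c'. hamiltonian_path V u v P \<and> H \<subseteq> path_edges P \<and>
        rainbow n G (path_edges P) c' \<and> (\<forall>e\<in>H. c' e = c e))
     \<or>
     (components (verts_with H u v) H =
          {component (verts_with H u v) H u, component (verts_with H u v) H v} \<and>
        (\<exists>X Y. partition2 (V - verts_with H u v) X Y \<and> card X \<ge> 1 \<and> card Y \<ge> 1 \<and>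
          (\<forall>i \<in> {1..n} - c ` H.
             clique (G i) X \<and> clique (G i) Y \<and> edges_between (G i) X Y = {} \<and>
             (\<forall>w \<in> verts_with H u v. \<forall>z \<in> X \<union> Y. {w, z} \<in> G i))))
     \<or>
     (\<exists>X Y. partition2 V X Y \<and>
        real (card X) = (real n + real k) / 2 \<and> real (card Y) = (real n - real k) / 2 \<and>
        verts_with H u v \<subseteq> X \<and>
        (\<forall>i \<in> {1..n} - c ` H.
           complete_bipartite X Y (edges_between (G i) X Y) \<and> independent_set (G i) Y))"
proof (cases "\<exists>P c'. hamiltonian_path V u v P \<and> H \<subseteq> path_edges P \<and>
        rainbow n G (path_edges P) c' \<and> (\<forall>e\<in>H. c' e = c e)")
  case False
  note forest = hamiltonian_path_through_linear_forest[OF assms(2,8,9,12)]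
  have "H \<subseteq> Pow V"
    using assms(8,9) unfolding linear_forest_def simple_graph_def by auto
  then have finH: "finite H" using assms(2) by (simp add: finite_subset)
  have n: "n \<ge> 4" using assms(1) by (simp add: field_simps)
  have "rainbow_setup V G H c k n u v"
  proof
    fix P c'
    assume "hamiltonian_path V u v P" "H \<subseteq> path_edges P" "rainbow n G (path_edges P) c'"
      "\<forall>e\<in>H. c' e = c e"
    with False show "False" by metis
  qed (use assms(2-5,10) n finH forest(1) in simp_all)
  moreover obtain xs where "distinct xs" "set xs = V" "insert {u, v} H \<subseteq> path_edges xs"
    using forest(2) by blast
  ultimately show ?thesis
    using assms(11) by (intro disjI2 rainbow_setup.extremal_structure)
qed (rule disjI1)

end
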